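(* Let $\alpha\colon E_*\to B_*$ be any morphism in the category $\mathcal{SCF}$ of strongly central filtrations. Then the restriction functor $\alpha^*\colon Pt_{B_*}(\mathcal{SCF})\to Pt_{E_*}(\mathcal{SCF})$ has a right adjoint (a co-induction functor along $\alpha$). Explicitly, writing $E=E_1$ and $B=B_1$, this right adjoint is given by $$Y_*\longmapsto \alpha_!(Y_* )=t^\infty\bigl(B_*,\hom_E(B,Y_* )\bigr),$$ which is the largest (for degreewise inclusion) strongly central filtration $H_*\subseteq \hom_E(B,Y_* )$ such that the action of $B$ on $\hom_E(B,Y_* )$ induces an action of $B_*$ on $H_*$.
   Context: A strongly central filtration $G_*$ is a nested sequence of groups $G_1\supseteq G_2\supseteq G_3\supseteq\cdots$ such that $[G_i,G_j]\subseteq G_{i+j}$ for all $i,j\geq 1$. The category $\mathcal{SCF}$ has these as objects; a morphism $G_*\to H_*$ is a group morphism $G_1\to H_1$ sending each $G_i$ into $H_i$. The inclusion $H_*\subseteq G_*$ means that $H_1$ is a subgroup of $G_1$ and $H_i\subseteq G_i$ for all $i$. An action of $B_*$ on $G_*$ in $\mathcal{SCF}$ is a group action of $B_1$ on $G_1$ by automorphisms such that $[B_i,G_j]\subseteq G_{i+j}$ for all $i,j\geq 1$, where commutators are taken in the semi-direct product $B_1\ltimes G_1$, i.e. $[b,g]=(b\cdot g)g^{-1}$. The category $Pt_{B_*}(\mathcal{SCF})$ (points over $B_*$, i.e. split epimorphisms onto $B_*$ with given sections) is identified with the category of strongly central filtrations endowed with a $B_*$-action, with morphisms the $B_1$-equivariant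 morphisms of $\mathcal{SCF}$. The restriction functor $\alpha^*$ (pullback of points along $\alpha$) restricts a $B_*$-action to an $E_*$-action along the group morphism $\alpha\colon E_1\to B_1$. For $Y_*$ with an action of $E_*$, $\hom_E(B,Y_* )$ is the strongly central filtration whose $i$-th term is the group (under pointwise multiplication) $\hom_E(B,Y_i)$ of maps of sets $u\colon B\to Y_i$ with $u(\alpha(e)b)=e\cdot u(b)$ for all $e\in E$, $b\in B$. The group $B$ acts on it by automorphisms preserving the filtration, via $(b\cdot u)(x)=u(xb)$. If $B_*$ and $G_*$ are strongly central filtrations and $B=B_1$ acts on $G=G_1$ by group automorphisms preserving the filtration $G_*$, put $t_i(B_*,G_* )=\{g\in G_i \mid \forall j\geq 1,\ [B_j,g]\subseteq G_{i+j}\}$, where $[B_j,g]=\{[b,g]\mid b\in B_j\}$; this is again a strongly central filtration stable under $B$. Set $t^0_*=G_*$, $t^{l+1}_*=t_*(B_*,t^l_* )$, and $t^\infty_i(B_*,G_* )=\bigcap_{l\geq 0}t^l_i$. *)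

theory Defs
  imports "HOL-Algebra.Bij" "HOL-Algebra.Generated_Groups"
begin

text \<open>
  A filtration \<open>G\<^sub>1 \<supseteq> G\<^sub>2 \<supseteq> \<dots>\<close> is stored as the group \<open>G\<^sub>1\<close> (the monoid part of the record)
  together with its terms \<open>filt G i\<close>.  Only the indices \<open>i \<ge> 1\<close> are meaningful; \<open>filt G 0\<close>
  is junk that no condition below ever inspects.
\<close>

record 'a filtered = "'a monoid" +
  filt :: "nat \<Rightarrow> 'a set"

definition commutator_subgroup :: "('a, 'm) monoid_scheme \<Rightarrow> 'a set \<Rightarrow> 'a set \<Rightarrow> 'a set" where
  "commutator_subgroup G S T =
     generate G {x \<otimes>\<^bsub>G\<^esub> y \<otimes>\<^bsub>G\<^esub> inv\<^bsub>G\<^esub> x \<otimes>\<^bsub>G\<^esub> inv\<^bsub>G\<^esub> y | x y. x \<in> S \<and> y \<in> T}"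

definition scf :: "('a, 'm) filtered_scheme \<Rightarrow> bool" where
  "scf G \<longleftrightarrow>
     group G \<and> filt G 1 = carrier G \<and>
     (\<forall>i\<ge>1. subgroup (filt G i) G) \<and>
     (\<forall>i\<ge>1. filt G (Suc i) \<subseteq> filt G i) \<and>
     (\<forall>i\<ge>1. \<forall>j\<ge>1. commutator_subgroup G (filt G i) (filt G j) \<subseteq> filt G (i + j))"

text \<open>
  Morphisms are extensional functions, so that equality of morphisms is equality in HOL;
  accordingly they are composed by \<^const>\<open>compose\<close>.
\<close>

definition scf_hom :: "('a, 'm) filtered_scheme \<Rightarrow> ('c, 'n) filtered_scheme \<Rightarrow> ('a \<Rightarrow> 'c) set" where
  "scf_hom G H =
     {f \<in> hom G H. f \<in> extensional (carrier G) \<and> (\<forall>i\<ge>1. f ` filt G i \<subseteq> filt H i)}"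

text \<open>
  A filtration over \<open>'a\<close> together with the operation on it of a group over \<open>'b\<close>.  That the
  operation is a group action by automorphisms is expressed by \<open>act P \<in> hom B (AutoGroup P)\<close>.
\<close>

record ('a, 'b) acted = "'a filtered" +
  act :: "'b \<Rightarrow> 'a \<Rightarrow> 'a"

definition act_commutators :: "('a, 'b) acted \<Rightarrow> 'b set \<Rightarrow> 'a set \<Rightarrow> 'a set" where
  "act_commutators P S T = {act P b x \<otimes>\<^bsub>P\<^esub> inv\<^bsub>P\<^esub> x | b x. b \<in> S \<and> x \<in> T}"

text \<open>
  The objects and morphisms of \<open>Pt\<^bsub>B\<^esub>(SCF)\<close>, viewed as strongly central filtrations with an
  action of the strongly central filtration \<open>B\<close>.
\<close>

definition pt_obj :: "'b filtered \<Rightarrow> ('a, 'b) acted \<Rightarrow> bool" where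
  "pt_obj B P \<longleftrightarrow>
     scf P \<and> act P \<in> hom B (AutoGroup P) \<and>
     (\<forall>i\<ge>1. \<forall>j\<ge>1. generate P (act_commutators P (filt B i) (filt P j)) \<subseteq> filt P (i + j))"

definition pt_hom :: "'b filtered \<Rightarrow> ('a, 'b) acted \<Rightarrow> ('c, 'b) acted \<Rightarrow> ('a \<Rightarrow> 'c) set" where
  "pt_hom B P Y =
     {f \<in> scf_hom P Y. \<forall>b\<in>carrier B. \<forall>x\<in>carrier P. f (act P b x) = act Y b (f x)}"

text \<open>
  The restriction functor \<open>\<alpha>\<^sup>*\<close> on objects; on morphisms it is the identity.
\<close>

definition restr :: "('e \<Rightarrow> 'b) \<Rightarrow> ('a, 'b) acted \<Rightarrow> ('a, 'e) acted" where
  "restr \<alpha> P =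
     \<lparr>carrier = carrier P, monoid.mult = mult P, one = one P, filt = filt P,
      act = (\<lambda>e. act P (\<alpha> e))\<rparr>"

text \<open>
  The filtration \<open>F\<close> of subgroups of \<open>P\<close>, with the structure inherited from \<open>P\<close>.
\<close>

definition sub_acted :: "('a, 'b) acted \<Rightarrow> (nat \<Rightarrow> 'a set) \<Rightarrow> ('a, 'b) acted" where
  "sub_acted P F =
     P\<lparr>carrier := F 1, filt := F, act := (\<lambda>b. restrict (act P b) (F 1))\<rparr>"

text \<open>
  \<open>F\<close> is a strongly central filtration included in \<open>P\<close>, on which the operation of \<open>B\<^sub>1\<close> on \<open>P\<close>
  induces an action of the filtration \<open>B\<close>.  Stability of \<open>F 1\<close> under \<open>B\<^sub>1\<close> is part of
  \<^const>\<open>pt_obj\<close>.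
\<close>

definition induces_action_on :: "'b filtered \<Rightarrow> ('a, 'b) acted \<Rightarrow> (nat \<Rightarrow> 'a set) \<Rightarrow> bool" where
  "induces_action_on B P F \<longleftrightarrow>
     subgroup (F 1) P \<and> (\<forall>i\<ge>1. F i \<subseteq> filt P i) \<and> pt_obj B (sub_acted P F)"

definition t_filt :: "'b filtered \<Rightarrow> ('a, 'b) acted \<Rightarrow> nat \<Rightarrow> 'a set" where
  "t_filt B P i = {g \<in> filt P i. \<forall>j\<ge>1. act_commutators P (filt B j) {g} \<subseteq> filt P (i + j)}"

definition t_iter :: "'b filtered \<Rightarrow> ('a, 'b) acted \<Rightarrow> nat \<Rightarrow> ('a, 'b) acted" where
  "t_iter B P l = ((\<lambda>Z. sub_acted Z (t_filt B Z)) ^^ l) P"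

definition t_inf :: "'b filtered \<Rightarrow> ('a, 'b) acted \<Rightarrow> nat \<Rightarrow> 'a set" where
  "t_inf B P i = (\<Inter>l. filt (t_iter B P l) i)"

definition equivariant_maps ::
  "'e filtered \<Rightarrow> 'b filtered \<Rightarrow> ('e \<Rightarrow> 'b) \<Rightarrow> ('y, 'e) acted \<Rightarrow> 'y set \<Rightarrow> ('b \<Rightarrow> 'y) set" where
  "equivariant_maps E B \<alpha> Y S =
     {u \<in> carrier B \<rightarrow>\<^sub>E S.
        \<forall>e\<in>carrier E. \<forall>b\<in>carrier B. u (\<alpha> e \<otimes>\<^bsub>B\<^esub> b) = act Y e (u b)}"

text \<open>
  \<open>hom\<^bsub>E\<^esub>(B, Y)\<close> with the operation \<open>(b \<cdot> u)(x) = u(xb)\<close> of \<open>B\<^sub>1\<close>.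
\<close>

definition hom_acted ::
  "'e filtered \<Rightarrow> 'b filtered \<Rightarrow> ('e \<Rightarrow> 'b) \<Rightarrow> ('y, 'e) acted \<Rightarrow> ('b \<Rightarrow> 'y, 'b) acted" where
  "hom_acted E B \<alpha> Y =
     \<lparr>carrier = equivariant_maps E B \<alpha> Y (carrier Y),
      monoid.mult = (\<lambda>u v. \<lambda>x\<in>carrier B. u x \<otimes>\<^bsub>Y\<^esub> v x),
      one = (\<lambda>x\<in>carrier B. \<one>\<^bsub>Y\<^esub>),
      filt = (\<lambda>i. equivariant_maps E B \<alpha> Y (filt Y i)),
      act = (\<lambda>b. \<lambda>u\<in>equivariant_maps E B \<alpha> Y (carrier Y). \<lambda>x\<in>carrier B. u (x \<otimes>\<^bsub>B\<^esub> b))\<rparr>"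

text \<open>
  The co-induction functor \<open>\<alpha>\<^sub>!\<close> on objects and on morphisms \<open>f : Y \<rightarrow> Y'\<close> (post-composition).
\<close>

definition coind ::
  "'e filtered \<Rightarrow> 'b filtered \<Rightarrow> ('e \<Rightarrow> 'b) \<Rightarrow> ('y, 'e) acted \<Rightarrow> ('b \<Rightarrow> 'y, 'b) acted" where
  "coind E B \<alpha> Y = sub_acted (hom_acted E B \<alpha> Y) (t_inf B (hom_acted E B \<alpha> Y))"

definition coind_map ::
  "'e filtered \<Rightarrow> 'b filtered \<Rightarrow> ('e \<Rightarrow> 'b) \<Rightarrow> ('y, 'e) acted \<Rightarrow> ('y \<Rightarrow> 'z) \<Rightarrow>
   ('b \<Rightarrow> 'y) \<Rightarrow> ('b \<Rightarrow> 'z)" where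
  "coind_map E B \<alpha> Y f = (\<lambda>u\<in>carrier (coind E B \<alpha> Y). compose (carrier B) f u)"

text \<open>
  The counit \<open>\<alpha>\<^sup>*\<alpha>\<^sub>!Y \<rightarrow> Y\<close>, evaluation at the unit of \<open>B\<^sub>1\<close>, and the adjunction map
  \<open>Hom(P, \<alpha>\<^sub>!Y) \<rightarrow> Hom(\<alpha>\<^sup>*P, Y)\<close> it defines.
\<close>

definition coind_counit ::
  "'e filtered \<Rightarrow> 'b filtered \<Rightarrow> ('e \<Rightarrow> 'b) \<Rightarrow> ('y, 'e) acted \<Rightarrow> ('b \<Rightarrow> 'y) \<Rightarrow> 'y" where
  "coind_counit E B \<alpha> Y = (\<lambda>u\<in>carrier (coind E B \<alpha> Y). u \<one>\<^bsub>B\<^esub>)"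

definition coind_adj ::
  "'e filtered \<Rightarrow> 'b filtered \<Rightarrow> ('e \<Rightarrow> 'b) \<Rightarrow> ('x, 'b) acted \<Rightarrow> ('y, 'e) acted \<Rightarrow>
   ('x \<Rightarrow> 'b \<Rightarrow> 'y) \<Rightarrow> ('x \<Rightarrow> 'y)" where
  "coind_adj E B \<alpha> P Y g = compose (carrier P) (coind_counit E B \<alpha> Y) g"

end

theory Submission
  imports Defs
begin

text \<open>
  Without filtrations, restriction of actions along \<open>E \<rightarrow> B\<close> has the right adjoint
  \<open>Y \<mapsto> hom\<^bsub>E\<^esub>(B, Y)\<close>: evaluation at the unit is the counit, and \<open>f : P \<rightarrow> Y\<close> has the transpose
  \<open>p \<mapsto> (x \<mapsto> f (x \<cdot> p))\<close> (\<open>coind_transpose\<close>).  The terms \<open>hom\<^bsub>E\<^esub>(B, Y\<^sub>i)\<close> form a strongly central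
  filtration stable under \<open>B\<close>, but \<open>[B\<^sub>j, hom\<^bsub>E\<^esub>(B, Y\<^sub>i)]\<close> need not lie in \<open>hom\<^bsub>E\<^esub>(B, Y\<^sub>i\<^sub>+\<^sub>j)\<close>, so
  \<open>B\<^sub>*\<close> does not act.  The remedy is to pass to the largest filtration inside on which it does.

  The limit \<open>t\<^sup>\<infinity>\<close> is this largest filtration.  One application of \<open>t\<close> keeps a strongly central
  filtration strongly central and \<open>B\<close>-stable (\<open>invariant_filtration_central_part\<close>); the point
  needing work is \<open>[t\<^sub>i, t\<^sub>k] \<subseteq> t\<^sub>i\<^sub>+\<^sub>k\<close>, where an element of \<open>B\<^sub>j\<close> perturbs both entries of a
  commutator by elements lying \<open>j\<close> steps deeper (\<open>central_part_commutator\<close>).  Intersecting over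
  all stages, an element of \<open>t\<^sup>\<infinity>\<^sub>i\<close> lies in \<open>t\<^sup>l\<^sup>+\<^sup>1\<^sub>i\<close>, so its commutators with \<open>B\<^sub>j\<close> lie in
  \<open>t\<^sup>l\<^sub>i\<^sub>+\<^sub>j\<close> for every \<open>l\<close>: \<open>B\<^sub>*\<close> acts on \<open>t\<^sup>\<infinity>\<close>.  Conversely, induction on \<open>l\<close> shows that any
  family \<open>F\<close> with \<open>F\<^sub>i \<subseteq> hom\<^bsub>E\<^esub>(B, Y\<^sub>i)\<close> and \<open>[B\<^sub>j, F\<^sub>i] \<subseteq> F\<^sub>i\<^sub>+\<^sub>j\<close> stays inside each \<open>t\<^sup>l\<close>
  (\<open>centrally_moved_subset_t_inf\<close>).

  This last lemma gives maximality, and it also gives the adjunction: the image of \<open>P\<^sub>*\<close> under the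
  transpose of \<open>f\<close> is such a family, because the transpose commutes with \<open>B\<close> and
  \<open>[B\<^sub>j, P\<^sub>i] \<subseteq> P\<^sub>i\<^sub>+\<^sub>j\<close>.  So the transpose factors through \<open>t\<^sup>\<infinity>\<close>, and the bijection without
  filtrations restricts to one between morphisms of \<open>Pt\<close>.
\<close>

section \<open>Elementwise form of the filtration axioms\<close>

lemma (in group) generate_pairs_subset_iff:
  assumes "subgroup H G"
  shows "generate G {f x y | x y. x \<in> S \<and> y \<in> T} \<subseteq> H \<longleftrightarrow> (\<forall>x\<in>S. \<forall>y\<in>T. f x y \<in> H)"
proof -
  have "generate G K \<subseteq> H \<longleftrightarrow> K \<subseteq> H" for K
    using generate_subgroup_incl[OF _ assms, of K] by (auto intro: generate.incl)
  then have "generate G {f x y | x y. x \<in> S \<and> y \<in> T} \<subseteq> H \<longleftrightarrow>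
      {f x y | x y. x \<in> S \<and> y \<in> T} \<subseteq> H" .
  also have "\<dots> \<longleftrightarrow> (\<forall>x\<in>S. \<forall>y\<in>T. f x y \<in> H)" by blast
  finally show ?thesis .
qed

lemma (in group) mult_inv_cancel:
  assumes "x \<in> carrier G" "y \<in> carrier G"
  shows "x \<otimes> (inv x \<otimes> y) = y" "inv x \<otimes> (x \<otimes> y) = y"
  using assms by (simp_all add: m_assoc[symmetric] del: m_assoc)

lemma scf_iff:
  "scf G \<longleftrightarrow>
     group G \<and> filt G 1 = carrier G \<and>
     (\<forall>i\<ge>1. subgroup (filt G i) G) \<and>
     (\<forall>i\<ge>1. filt G (Suc i) \<subseteq> filt G i) \<and>
     (\<forall>i\<ge>1. \<forall>j\<ge>1. \<forall>x\<in>filt G i. \<forall>y\<in>filt G j.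
        x \<otimes>\<^bsub>G\<^esub> y \<otimes>\<^bsub>G\<^esub> inv\<^bsub>G\<^esub> x \<otimes>\<^bsub>G\<^esub> inv\<^bsub>G\<^esub> y \<in> filt G (i + j))"
proof -
  have "commutator_subgroup G (filt G i) (filt G j) \<subseteq> filt G (i + j) \<longleftrightarrow>
      (\<forall>x\<in>filt G i. \<forall>y\<in>filt G j.
        x \<otimes>\<^bsub>G\<^esub> y \<otimes>\<^bsub>G\<^esub> inv\<^bsub>G\<^esub> x \<otimes>\<^bsub>G\<^esub> inv\<^bsub>G\<^esub> y \<in> filt G (i + j))"
    if "group G" "\<forall>i\<ge>1. subgroup (filt G i) G" "i \<ge> 1" for i j
    using that unfolding commutator_subgroup_def
    by (intro group.generate_pairs_subset_iff) auto
  then show ?thesis unfolding scf_def by (simp cong: conj_cong)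
qed

text \<open>
  Since \<open>x n x\<^sup>-\<^sup>1 = [x, n] n\<close>, strong centrality makes every term normal.
\<close>

lemma scf_conj_closed:
  assumes "scf G" "i \<ge> 1" "x \<in> carrier G" "n \<in> filt G i"
  shows "x \<otimes>\<^bsub>G\<^esub> n \<otimes>\<^bsub>G\<^esub> inv\<^bsub>G\<^esub> x \<in> filt G i"
proof -
  interpret group G using assms(1) by (simp add: scf_def)
  have sub: "subgroup (filt G i) G" and n: "n \<in> carrier G"
    using assms subgroup.subset by (fastforce simp: scf_def)+
  have x: "x \<in> filt G 1" and decr: "filt G (Suc i) \<subseteq> filt G i"
    using assms by (simp_all add: scf_def)
  have "\<forall>i\<ge>1. \<forall>j\<ge>1. \<forall>x\<in>filt G i. \<forall>y\<in>filt G j.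
      x \<otimes>\<^bsub>G\<^esub> y \<otimes>\<^bsub>G\<^esub> inv\<^bsub>G\<^esub> x \<otimes>\<^bsub>G\<^esub> inv\<^bsub>G\<^esub> y \<in> filt G (i + j)"
    using assms(1) unfolding scf_iff by (elim conjE)
  then have "x \<otimes>\<^bsub>G\<^esub> n \<otimes>\<^bsub>G\<^esub> inv\<^bsub>G\<^esub> x \<otimes>\<^bsub>G\<^esub> inv\<^bsub>G\<^esub> n \<in> filt G (1 + i)"
    using x assms(2,4) by (metis order_refl)
  then have c: "x \<otimes>\<^bsub>G\<^esub> n \<otimes>\<^bsub>G\<^esub> inv\<^bsub>G\<^esub> x \<otimes>\<^bsub>G\<^esub> inv\<^bsub>G\<^esub> n \<in> filt G i"
    using decr by auto
  have "x \<otimes>\<^bsub>G\<^esub> n \<otimes>\<^bsub>G\<^esub> inv\<^bsub>G\<^esub> x =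
      (x \<otimes>\<^bsub>G\<^esub> n \<otimes>\<^bsub>G\<^esub> inv\<^bsub>G\<^esub> x \<otimes>\<^bsub>G\<^esub> inv\<^bsub>G\<^esub> n) \<otimes>\<^bsub>G\<^esub> n"
    using assms(3) n by (simp add: m_assoc)
  then show ?thesis using subgroup.m_closed[OF sub c assms(4)] by simp
qed

section \<open>Operations of a strongly central filtration on a group\<close>

text \<open>
  A group action by automorphisms, as in \<open>act P \<in> hom B (AutoGroup P)\<close>, written out on elements.
  It says nothing about a filtration of \<open>P\<close>: the filtrations vary below while \<open>P\<close> stays.
\<close>

locale scf_operation =
  B: group B + group P for B :: "'b filtered" and P :: "('a, 'b) acted" (structure) +
  assumes scf_B: "scf B"
    and act_ext: "b \<in> carrier B \<Longrightarrow> act P b \<in> extensional (carrier P)"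
    and act_closed: "b \<in> carrier B \<Longrightarrow> x \<in> carrier P \<Longrightarrow> act P b x \<in> carrier P"
    and act_mult: "b \<in> carrier B \<Longrightarrow> x \<in> carrier P \<Longrightarrow> y \<in> carrier P \<Longrightarrow>
        act P b (x \<otimes> y) = act P b x \<otimes> act P b y"
    and act_one: "x \<in> carrier P \<Longrightarrow> act P \<one>\<^bsub>B\<^esub> x = x"
    and act_act: "b \<in> carrier B \<Longrightarrow> c \<in> carrier B \<Longrightarrow> x \<in> carrier P \<Longrightarrow>
        act P (b \<otimes>\<^bsub>B\<^esub> c) x = act P b (act P c x)"
begin

lemma filt_B: "j \<ge> 1 \<Longrightarrow> b \<in> filt B j \<Longrightarrow> b \<in> carrier B"
  using scf_B subgroup.mem_carrier[of "filt B j" B b] by (simp add: scf_def)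

lemma act_inv:
  assumes "b \<in> carrier B" "x \<in> carrier P"
  shows "act P b (inv x) = inv (act P b x)"
proof -
  have "act P b \<in> hom P P" using assms(1) by (auto intro!: homI act_closed act_mult)
  then interpret group_hom P P "act P b" by unfold_locales
  show ?thesis using assms(2) by simp
qed

end

text \<open>
  The bijectivity demanded by \<^const>\<open>AutoGroup\<close> comes for free: \<open>b\<^sup>-\<^sup>1\<close> operates as the inverse
  of \<open>b\<close>.
\<close>

lemma act_hom_AutoGroup_iff:
  assumes "scf B" "group P"
  shows "act P \<in> hom B (AutoGroup P) \<longleftrightarrow> scf_operation B P"
proof
  interpret B: group B using assms(1) by (simp add: scf_def)
  interpret P: group P by fact
  assume h: "act P \<in> hom B (AutoGroup P)"
  then interpret h: group_hom B "AutoGroup P" "act P"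
    by (simp add: group_hom_def group_hom_axioms_def B.is_group P.AutoGroup)
  have auto: "act P b \<in> hom P P" "act P b \<in> Bij (carrier P)" if "b \<in> carrier B" for b
    using h.hom_closed[OF that] by (auto simp: AutoGroup_def auto_def)
  have mult: "act P (b \<otimes>\<^bsub>B\<^esub> c) = compose (carrier P) (act P b) (act P c)"
    if "b \<in> carrier B" "c \<in> carrier B" for b c
    using h.hom_mult[OF that] auto(2)[OF that(1)] auto(2)[OF that(2)]
    by (simp add: AutoGroup_def BijGroup_def)
  have one: "act P \<one>\<^bsub>B\<^esub> = (\<lambda>x\<in>carrier P. x)"
    using h.hom_one by (simp add: AutoGroup_def BijGroup_def)
  show "scf_operation B P"
  proof
    show "act P b \<in> extensional (carrier P)" if "b \<in> carrier B" for b
      using auto(2)[OF that] by (simp add: Bij_def)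
  qed (use assms auto mult one in \<open>auto simp: hom_def compose_def\<close>)
next
  interpret B: group B using assms(1) by (simp add: scf_def)
  interpret P: group P by fact
  assume "scf_operation B P"
  then interpret scf_operation B P .
  have Bij: "act P b \<in> Bij (carrier P)" if b: "b \<in> carrier B" for b
  proof -
    have "bij_betw (act P b) (carrier P) (carrier P)"
      by (rule bij_betw_byWitness[where f' = "act P (inv\<^bsub>B\<^esub> b)"])
        (use b in \<open>auto simp: act_act[symmetric] act_one act_closed\<close>)
    then show ?thesis using act_ext[OF b] by (simp add: Bij_def)
  qed
  show "act P \<in> hom B (AutoGroup P)"
  proof (rule homI)
    fix b assume "b \<in> carrier B"
    then show "act P b \<in> carrier (AutoGroup P)"
      using Bij by (auto simp: AutoGroup_def auto_def intro!: homI act_closed act_mult)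
  next
    fix b c assume bc: "b \<in> carrier B" "c \<in> carrier B"
    have "act P (b \<otimes>\<^bsub>B\<^esub> c) = compose (carrier P) (act P b) (act P c)"
      using act_ext[of "b \<otimes>\<^bsub>B\<^esub> c"] bc
      by (auto simp: compose_def act_act extensional_def fun_eq_iff)
    then show "act P (b \<otimes>\<^bsub>B\<^esub> c) = act P b \<otimes>\<^bsub>AutoGroup P\<^esub> act P c"
      using Bij bc by (simp add: AutoGroup_def BijGroup_def)
  qed
qed

text \<open>
  Strongly central filtrations of a subgroup of \<open>P\<close> whose terms are stable under \<open>B\<^sub>1\<close>.  This is
  the input that the construction \<open>t\<close> accepts, and it produces the same kind of object; the filtration
  of \<open>hom\<^bsub>E\<^esub>(B, Y)\<close> is of this kind although \<open>B\<^sub>*\<close> need not act on it.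
\<close>

definition invariant_filtration ::
  "'b filtered \<Rightarrow> ('a, 'b) acted \<Rightarrow> (nat \<Rightarrow> 'a set) \<Rightarrow> bool" where
  "invariant_filtration B P F \<longleftrightarrow>
     (\<forall>i\<ge>1. subgroup (F i) P) \<and>
     (\<forall>i\<ge>1. F (Suc i) \<subseteq> F i) \<and>
     (\<forall>i\<ge>1. \<forall>j\<ge>1. \<forall>x\<in>F i. \<forall>y\<in>F j. x \<otimes>\<^bsub>P\<^esub> y \<otimes>\<^bsub>P\<^esub> inv\<^bsub>P\<^esub> x \<otimes>\<^bsub>P\<^esub> inv\<^bsub>P\<^esub> y \<in> F (i + j)) \<and>
     (\<forall>i\<ge>1. \<forall>b\<in>carrier B. \<forall>x\<in>F i. act P b x \<in> F i)"

text \<open>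
  The condition \<open>[B\<^sub>j, F\<^sub>i] \<subseteq> F\<^sub>i\<^sub>+\<^sub>j\<close> of an action of \<open>B\<^sub>*\<close>.  It is meaningful for families of
  mere subsets, and images of filtrations are used as such families.
\<close>

definition centrally_moved ::
  "'b filtered \<Rightarrow> ('a, 'b) acted \<Rightarrow> (nat \<Rightarrow> 'a set) \<Rightarrow> bool" where
  "centrally_moved B P F \<longleftrightarrow>
     (\<forall>i\<ge>1. \<forall>j\<ge>1. \<forall>b\<in>filt B j. \<forall>x\<in>F i. act P b x \<otimes>\<^bsub>P\<^esub> inv\<^bsub>P\<^esub> x \<in> F (i + j))"

text \<open>
  Invariance of the terms under the whole of \<open>B\<^sub>1\<close> is implied by the commutator condition with
  \<open>j = 1\<close>, since \<open>b \<cdot> x = [b, x] x\<close>.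
\<close>

lemma pt_obj_iff:
  assumes "scf B"
  shows "pt_obj B P \<longleftrightarrow>
    scf_operation B P \<and> filt P 1 = carrier P \<and>
    invariant_filtration B P (filt P) \<and> centrally_moved B P (filt P)"
proof -
  have comm: "(\<forall>i\<ge>1. \<forall>j\<ge>1. generate P (act_commutators P (filt B i) (filt P j)) \<subseteq> filt P (i + j))
      \<longleftrightarrow> centrally_moved B P (filt P)"
    if P: "group P" "\<forall>i\<ge>1. subgroup (filt P i) P"
  proof -
    have "generate P (act_commutators P (filt B i) (filt P j)) \<subseteq> filt P (i + j) \<longleftrightarrow>
        (\<forall>b\<in>filt B i. \<forall>x\<in>filt P j. act P b x \<otimes>\<^bsub>P\<^esub> inv\<^bsub>P\<^esub> x \<in> filt P (j + i))"
      if "i \<ge> 1" for i j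
      using P that unfolding act_commutators_def add.commute[of j i]
      by (intro group.generate_pairs_subset_iff) auto
    then show ?thesis unfolding centrally_moved_def by blast
  qed
  have inv: "act P b x \<in> filt P i"
    if "scf P" "scf_operation B P" "centrally_moved B P (filt P)"
      and i: "i \<ge> 1" and b: "b \<in> carrier B" and x: "x \<in> filt P i" for i b x
  proof -
    interpret scf_operation B P by fact
    have sub: "subgroup (filt P i) P" and decr: "filt P (Suc i) \<subseteq> filt P i"
      using that by (simp_all add: scf_def)
    then have xc: "x \<in> carrier P" using x by (blast intro: subgroup.mem_carrier)
    have "b \<in> filt B 1" using b assms by (simp add: scf_def)
    then have "act P b x \<otimes>\<^bsub>P\<^esub> inv\<^bsub>P\<^esub> x \<in> filt P (i + 1)"
      using that(3) i x unfolding centrally_moved_def by (metis order_refl)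
    then have "act P b x \<otimes>\<^bsub>P\<^esub> inv\<^bsub>P\<^esub> x \<in> filt P i" using decr by auto
    then have "act P b x \<otimes>\<^bsub>P\<^esub> inv\<^bsub>P\<^esub> x \<otimes>\<^bsub>P\<^esub> x \<in> filt P i"
      using x sub by (simp add: subgroup.m_closed)
    then show ?thesis using b xc by (simp add: m_assoc act_closed)
  qed
  show ?thesis
  proof
    assume P: "pt_obj B P"
    then have s: "scf P" and "act P \<in> hom B (AutoGroup P)" by (auto simp: pt_obj_def)
    then have op: "scf_operation B P"
      using act_hom_AutoGroup_iff[OF assms, of P] by (simp add: scf_def[of P])
    have c: "centrally_moved B P (filt P)"
      using P comm by (simp add: pt_obj_def scf_def)
    show "scf_operation B P \<and> filt P 1 = carrier P \<and>
        invariant_filtration B P (filt P) \<and> centrally_moved B P (filt P)"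
      using s op c inv[OF s op c] by (simp add: scf_iff invariant_filtration_def)
  next
    assume P: "scf_operation B P \<and> filt P 1 = carrier P \<and>
        invariant_filtration B P (filt P) \<and> centrally_moved B P (filt P)"
    then interpret scf_operation B P by blast
    have s: "scf P"
      using P is_group by (simp add: scf_iff invariant_filtration_def)
    then show "pt_obj B P"
      using P comm act_hom_AutoGroup_iff[OF assms is_group]
      unfolding pt_obj_def by (simp add: scf_def)
  qed
qed

lemma pt_objD:
  assumes "scf B" "pt_obj B P"
  shows "scf_operation B P" "filt P 1 = carrier P"
    "invariant_filtration B P (filt P)" "centrally_moved B P (filt P)"
  using assms(2) unfolding pt_obj_iff[OF assms(1)] by simp_all

section \<open>The filtration t of an invariant filtration\<close>

context scf_operation
begin

text \<open>
  The construction \<open>t\<close>, for varying filtrations of the fixed group \<open>P\<close> rather than for an acted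
  filtration whose underlying group shrinks at each step of the iteration.
\<close>

definition central_part :: "(nat \<Rightarrow> 'a set) \<Rightarrow> nat \<Rightarrow> 'a set" where
  "central_part F i =
     {g \<in> F i. \<forall>j\<ge>1. \<forall>b\<in>filt B j. act P b g \<otimes> inv g \<in> F (i + j)}"

lemma invariant_filtration_cong:
  assumes "\<And>i. i \<ge> 1 \<Longrightarrow> F i = F' i"
  shows "invariant_filtration B P F \<longleftrightarrow> invariant_filtration B P F'"
  using assms unfolding invariant_filtration_def by (simp add: trans_le_add1)

context
  fixes F :: "nat \<Rightarrow> 'a set"
  assumes inv_filt: "invariant_filtration B P F"
begin

lemma term_subgroup: "i \<ge> 1 \<Longrightarrow> subgroup (F i) P"
  using inv_filt by (simp add: invariant_filtration_def)

lemma term_carrier: "i \<ge> 1 \<Longrightarrow> x \<in> F i \<Longrightarrow> x \<in> carrier P"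
  by (rule subgroup.mem_carrier[OF term_subgroup])

lemma term_mult: "i \<ge> 1 \<Longrightarrow> x \<in> F i \<Longrightarrow> y \<in> F i \<Longrightarrow> x \<otimes> y \<in> F i"
  by (rule subgroup.m_closed[OF term_subgroup])

lemma term_inv: "i \<ge> 1 \<Longrightarrow> x \<in> F i \<Longrightarrow> inv x \<in> F i"
  by (rule subgroup.m_inv_closed[OF term_subgroup])

lemma term_antimono:
  assumes "1 \<le> i" "i \<le> j"
  shows "F j \<subseteq> F i"
  using assms(2)
proof (induction j rule: dec_induct)
  case (step j)
  moreover have "F (Suc j) \<subseteq> F j" using inv_filt assms(1) step.hyps by (simp add: invariant_filtration_def)
  ultimately show ?case using step.IH by blast
qed simp

lemma term_act: "i \<ge> 1 \<Longrightarrow> b \<in> carrier B \<Longrightarrow> x \<in> F i \<Longrightarrow> act P b x \<in> F i"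
  using inv_filt by (simp add: invariant_filtration_def)

lemma term_commutator:
  "i \<ge> 1 \<Longrightarrow> j \<ge> 1 \<Longrightarrow> x \<in> F i \<Longrightarrow> y \<in> F j \<Longrightarrow> i + j = k \<Longrightarrow>
     x \<otimes> y \<otimes> inv x \<otimes> inv y \<in> F k"
  using inv_filt unfolding invariant_filtration_def by blast

lemma term_conj:
  assumes "i \<ge> 1" "k \<ge> 1" "x \<in> F k" "n \<in> F i"
  shows "x \<otimes> n \<otimes> inv x \<in> F i"
proof -
  have "x \<otimes> n \<otimes> inv x \<otimes> inv n \<in> F (k + i)" using assms term_commutator by blast
  then have "x \<otimes> n \<otimes> inv x \<otimes> inv n \<otimes> n \<in> F i"
    using assms term_antimono[of i "k + i"] by (auto intro: term_mult)
  then show ?thesis using assms term_carrier by (simp add: m_assoc)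
qed

text \<open>
  Perturbing \<open>g\<close> by \<open>x\<close> changes \<open>[g, z]\<close> only by \<open>[x, [g, z]]\<close> and a conjugate of
  \<open>[x, z]\<close>, and both lie deep in the filtration.  The next lemma is the same in the second argument.
\<close>

lemma commutator_perturb_left:
  assumes i: "i \<ge> 1" and k: "k \<ge> 1"
    and x: "x \<in> F (i + j)" and g: "g \<in> F i" and z: "z \<in> F k"
  shows "(x \<otimes> g \<otimes> z \<otimes> inv (x \<otimes> g) \<otimes> inv z) \<otimes> inv (g \<otimes> z \<otimes> inv g \<otimes> inv z)
    \<in> F (i + j + k)"
proof -
  let ?c = "g \<otimes> z \<otimes> inv g \<otimes> inv z"
  have car: "x \<in> carrier P" "g \<in> carrier P" "z \<in> carrier P"
    using term_carrier[OF _ x] term_carrier[OF i g] term_carrier[OF k z] i by simp_all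
  have c: "?c \<in> F (i + k)" using assms term_commutator by blast
  then have cF: "?c \<in> F k" using k term_antimono[of k "i + k"] by auto
  have xc: "x \<otimes> ?c \<otimes> inv x \<otimes> inv ?c \<in> F (i + j + k)"
    using term_commutator[OF _ k x cF] i by simp
  have xz: "x \<otimes> z \<otimes> inv x \<otimes> inv z \<in> F (i + j + k)"
    using term_commutator[OF _ k x z] i by simp
  have "(x \<otimes> g \<otimes> z \<otimes> inv (x \<otimes> g) \<otimes> inv z) \<otimes> inv ?c
      = (x \<otimes> ?c \<otimes> inv x \<otimes> inv ?c) \<otimes> (?c \<otimes> (x \<otimes> z \<otimes> inv x \<otimes> inv z) \<otimes> inv ?c)"
    using car by (simp add: m_assoc inv_mult_group mult_inv_cancel)
  moreover have "?c \<otimes> (x \<otimes> z \<otimes> inv x \<otimes> inv z) \<otimes> inv ?c \<in> F (i + j + k)"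
    using assms c xz by (intro term_conj[of _ "i + k"]) auto
  ultimately show ?thesis using xc i by (simp add: term_mult)
qed

lemma commutator_perturb_right:
  assumes i: "i \<ge> 1" and k: "k \<ge> 1"
    and y: "y \<in> F (k + j)" and g: "g \<in> F i" and h: "h \<in> F k"
  shows "(g \<otimes> (y \<otimes> h) \<otimes> inv g \<otimes> inv (y \<otimes> h)) \<otimes> inv (g \<otimes> h \<otimes> inv g \<otimes> inv h)
    \<in> F (i + j + k)"
proof -
  let ?c = "g \<otimes> h \<otimes> inv g \<otimes> inv h"
  have car: "y \<in> carrier P" "g \<in> carrier P" "h \<in> carrier P"
    using term_carrier[OF _ y] term_carrier[OF i g] term_carrier[OF k h] k by simp_all
  have "?c \<in> F (i + k)" using assms term_commutator by blast
  then have cF: "?c \<in> F i" using i term_antimono[of i "i + k"] by auto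
  have yc: "y \<otimes> ?c \<otimes> inv y \<otimes> inv ?c \<in> F (i + j + k)"
    using term_commutator[OF _ i y cF] k by (simp add: ac_simps)
  have gy: "g \<otimes> y \<otimes> inv g \<otimes> inv y \<in> F (i + j + k)"
    using term_commutator[OF i _ g y] k by (simp add: ac_simps)
  have "(g \<otimes> (y \<otimes> h) \<otimes> inv g \<otimes> inv (y \<otimes> h)) \<otimes> inv ?c
      = (g \<otimes> y \<otimes> inv g \<otimes> inv y) \<otimes> (y \<otimes> ?c \<otimes> inv y \<otimes> inv ?c)"
    using car by (simp add: m_assoc inv_mult_group mult_inv_cancel)
  then show ?thesis using yc gy i by (simp add: term_mult)
qed

text \<open>
  Closure under products rests on \<open>[b, g h] = [b, g] (g [b, h] g\<^sup>-\<^sup>1)\<close>, closure under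
  inverses on \<open>[b, g\<^sup>-\<^sup>1] = g\<^sup>-\<^sup>1 [b, g]\<^sup>-\<^sup>1 g\<close>; the terms of \<open>F\<close> absorb the conjugations.
\<close>

lemma central_part_subgroup:
  assumes i: "i \<ge> 1"
  shows "subgroup (central_part F i) P"
proof
  show "central_part F i \<subseteq> carrier P"
    using term_carrier[OF i] by (auto simp: central_part_def)
next
  fix g h assume gh: "g \<in> central_part F i" "h \<in> central_part F i"
  then have g: "g \<in> F i" and h: "h \<in> F i" by (auto simp: central_part_def)
  have car: "g \<in> carrier P" "h \<in> carrier P" using g h i term_carrier by auto
  have "act P b (g \<otimes> h) \<otimes> inv (g \<otimes> h) \<in> F (i + j)" if j: "j \<ge> 1" and b: "b \<in> filt B j" for j b
  proof -
    have bc: "b \<in> carrier B" using filt_B j b .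
    have bg: "act P b g \<otimes> inv g \<in> F (i + j)" and bh: "act P b h \<otimes> inv h \<in> F (i + j)"
      using gh j b by (auto simp: central_part_def)
    have "act P b (g \<otimes> h) \<otimes> inv (g \<otimes> h)
        = (act P b g \<otimes> inv g) \<otimes> (g \<otimes> (act P b h \<otimes> inv h) \<otimes> inv g)"
      using car bc by (simp add: act_mult act_closed m_assoc inv_mult_group mult_inv_cancel)
    moreover have "g \<otimes> (act P b h \<otimes> inv h) \<otimes> inv g \<in> F (i + j)"
      using term_conj[of "i + j" i] i g bh by simp
    ultimately show ?thesis using bg i by (simp add: term_mult)
  qed
  then show "g \<otimes> h \<in> central_part F i"
    using g h i by (simp add: central_part_def term_mult)
next
  have "act P b \<one> \<otimes> inv \<one> = \<one>" if "j \<ge> 1" "b \<in> filt B j" for j b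
    using act_mult[of b \<one> \<one>] act_closed[of b \<one>] filt_B[OF that]
    by (simp add: r_cancel_one' l_cancel_one)
  then show "\<one> \<in> central_part F i"
    using term_subgroup i by (simp add: central_part_def subgroup.one_closed)
next
  fix g assume gt: "g \<in> central_part F i"
  then have g: "g \<in> F i" by (auto simp: central_part_def)
  have car: "g \<in> carrier P" using g i term_carrier by auto
  have "act P b (inv g) \<otimes> inv (inv g) \<in> F (i + j)" if j: "j \<ge> 1" and b: "b \<in> filt B j" for j b
  proof -
    have bc: "b \<in> carrier B" using filt_B j b .
    have bg: "inv (act P b g \<otimes> inv g) \<in> F (i + j)"
      using gt j b i by (auto simp: central_part_def intro: term_inv)
    have "act P b (inv g) \<otimes> inv (inv g)
        = inv g \<otimes> inv (act P b g \<otimes> inv g) \<otimes> inv (inv g)"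
      using car bc by (simp add: act_inv act_closed m_assoc inv_mult_group mult_inv_cancel)
    then show ?thesis
      using term_conj[of "i + j" i "inv g"] i g bg term_inv by simp
  qed
  then show "inv g \<in> central_part F i"
    using g i by (simp add: central_part_def term_inv)
qed

text \<open>
  Here normality of the terms of \<open>B\<close> enters: \<open>[b, c g] = c [c\<^sup>-\<^sup>1 b c, g]\<close>.
\<close>

lemma central_part_act:
  assumes i: "i \<ge> 1" and c: "c \<in> carrier B" and g: "g \<in> central_part F i"
  shows "act P c g \<in> central_part F i"
proof -
  have gF: "g \<in> F i" using g by (simp add: central_part_def)
  then have gc: "g \<in> carrier P" using i term_carrier by auto
  have "act P b (act P c g) \<otimes> inv (act P c g) \<in> F (i + j)"
    if j: "j \<ge> 1" and b: "b \<in> filt B j" for j b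
  proof -
    have bc: "b \<in> carrier B" using filt_B j b .
    let ?d = "inv\<^bsub>B\<^esub> c \<otimes>\<^bsub>B\<^esub> b \<otimes>\<^bsub>B\<^esub> c"
    have d: "?d \<in> filt B j"
      using scf_conj_closed[OF scf_B j _ b, of "inv\<^bsub>B\<^esub> c"] c by simp
    then have "act P ?d g \<otimes> inv g \<in> F (i + j)" using g j by (auto simp: central_part_def)
    then have "act P c (act P ?d g \<otimes> inv g) \<in> F (i + j)" using i c by (simp add: term_act)
    moreover have "c \<otimes>\<^bsub>B\<^esub> ?d = b \<otimes>\<^bsub>B\<^esub> c"
      using bc c by (simp add: B.m_assoc[symmetric])
    then have "act P c (act P ?d g) = act P b (act P c g)"
      using bc c gc by (simp flip: act_act)
    ultimately show ?thesis
      using c bc gc by (simp add: act_mult act_inv act_closed)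
  qed
  then show ?thesis using term_act[OF i c gF] by (simp add: central_part_def)
qed

text \<open>
  An element \<open>b\<close> turns \<open>[g, h]\<close> into the commutator of the perturbed elements \<open>[b, g] g\<close> and
  \<open>[b, h] h\<close>, and perturbations of that depth do not matter modulo \<open>F (i + j + k)\<close>.
\<close>

lemma central_part_commutator:
  assumes i: "i \<ge> 1" and k: "k \<ge> 1" and g: "g \<in> central_part F i" and h: "h \<in> central_part F k"
  shows "g \<otimes> h \<otimes> inv g \<otimes> inv h \<in> central_part F (i + k)"
proof -
  let ?c = "g \<otimes> h \<otimes> inv g \<otimes> inv h"
  have gF: "g \<in> F i" and hF: "h \<in> F k" using g h by (auto simp: central_part_def)
  have car: "g \<in> carrier P" "h \<in> carrier P" using gF hF i k term_carrier by auto
  have "act P b ?c \<otimes> inv ?c \<in> F (i + k + j)" if j: "j \<ge> 1" and b: "b \<in> filt B j" for j b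
  proof -
    have bc: "b \<in> carrier B" using filt_B j b .
    let ?x = "act P b g \<otimes> inv g" and ?z = "act P b h"
    let ?y = "?z \<otimes> inv h"
    have x: "?x \<in> F (i + j)" and y: "?y \<in> F (k + j)"
      using g h j b by (auto simp: central_part_def)
    have cars: "act P b g \<in> carrier P" "?z \<in> carrier P" using car bc act_closed by auto
    have xg: "?x \<otimes> g = act P b g" and yh: "?y \<otimes> h = ?z"
      using car cars by (simp_all add: m_assoc)
    have bcomm: "act P b ?c = act P b g \<otimes> ?z \<otimes> inv (act P b g) \<otimes> inv ?z"
      using car bc by (simp add: act_mult act_inv)
    have 1: "act P b ?c \<otimes> inv (g \<otimes> ?z \<otimes> inv g \<otimes> inv ?z) \<in> F (i + j + k)"
      using commutator_perturb_left[OF i k x gF term_act[OF k bc hF]]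
      unfolding xg bcomm .
    have 2: "(g \<otimes> ?z \<otimes> inv g \<otimes> inv ?z) \<otimes> inv ?c \<in> F (i + j + k)"
      using commutator_perturb_right[OF i k y gF hF] unfolding yh .
    have "act P b ?c \<otimes> inv ?c =
        (act P b ?c \<otimes> inv (g \<otimes> ?z \<otimes> inv g \<otimes> inv ?z)) \<otimes> ((g \<otimes> ?z \<otimes> inv g \<otimes> inv ?z) \<otimes> inv ?c)"
      using car cars bc act_closed[OF bc, of ?c]
      by (simp add: m_assoc inv_mult_group mult_inv_cancel)
    then have "act P b ?c \<otimes> inv ?c \<in> F (i + j + k)"
      using term_mult[OF _ 1 2] i by simp
    then show ?thesis by (simp add: ac_simps)
  qed
  then show ?thesis using term_commutator[OF i k gF hF] by (simp add: central_part_def)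
qed

lemma central_part_antimono:
  assumes "i \<ge> 1"
  shows "central_part F (Suc i) \<subseteq> central_part F i"
  using term_antimono[of i "Suc i"] term_antimono[of "i + j" "Suc i + j" for j] assms
  unfolding central_part_def by fastforce

lemma invariant_filtration_central_part: "invariant_filtration B P (central_part F)"
  using central_part_subgroup central_part_antimono central_part_commutator central_part_act
  unfolding invariant_filtration_def by blast

end

lemma invariant_filtration_Inter:
  assumes "\<And>l :: nat. invariant_filtration B P (F l)"
  shows "invariant_filtration B P (\<lambda>i. \<Inter>l. F l i)"
proof -
  have "subgroup (\<Inter>l. F l i) P" if "i \<ge> 1" for i
    using assms that by (intro subgroups_Inter) (auto simp: invariant_filtration_def simp del: One_nat_def)
  moreover have "(\<Inter>l. F l (Suc i)) \<subseteq> (\<Inter>l. F l i)" if "i \<ge> 1" for i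
    using assms that by (intro INF_mono') (simp add: invariant_filtration_def)
  ultimately show ?thesis
    using assms by (simp add: invariant_filtration_def)
qed

end

section \<open>The limit of the iterated filtrations\<close>

lemma sub_acted_simps [simp]:
  "carrier (sub_acted P F) = F 1" "mult (sub_acted P F) = mult P" "one (sub_acted P F) = one P"
  "filt (sub_acted P F) = F" "act (sub_acted P F) b = restrict (act P b) (F 1)"
  by (simp_all add: sub_acted_def)

lemma sub_acted_sub_acted:
  "F' 1 \<subseteq> F 1 \<Longrightarrow> sub_acted (sub_acted P F) F' = sub_acted P F'"
  by (simp add: sub_acted_def Int_absorb1)

context scf_operation
begin

lemma group_sub_acted:
  assumes "subgroup (F 1) P"
  shows "group (sub_acted P F)"
proof (rule groupI)
  fix x assume x: "x \<in> carrier (sub_acted P F)"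
  then show "\<exists>y\<in>carrier (sub_acted P F). y \<otimes>\<^bsub>sub_acted P F\<^esub> x = \<one>\<^bsub>sub_acted P F\<^esub>"
    using subgroup.m_inv_closed[OF assms] subgroup.mem_carrier[OF assms]
    by (auto intro!: bexI[of _ "inv x"] simp del: One_nat_def)
qed (use subgroup.mem_carrier[OF assms] subgroup.m_closed[OF assms] subgroup.one_closed[OF assms]
      in \<open>simp_all add: m_assoc del: One_nat_def\<close>)

lemma inv_sub_acted:
  assumes "subgroup (F 1) P" "x \<in> F 1"
  shows "inv\<^bsub>sub_acted P F\<^esub> x = inv x"
  using m_inv_consistent[OF assms] by (simp add: m_inv_def sub_acted_def)

lemma subgroup_sub_acted:
  assumes "subgroup (F 1) P" "subgroup K P" "K \<subseteq> F 1"
  shows "subgroup K (sub_acted P F)"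
proof
  fix x assume "x \<in> K"
  then show "inv\<^bsub>sub_acted P F\<^esub> x \<in> K"
    using assms by (auto simp: inv_sub_acted subgroup.m_inv_closed)
qed (use assms in \<open>auto simp: subgroup.one_closed subgroup.m_closed\<close>)

context
  fixes F :: "nat \<Rightarrow> 'a set"
  assumes F: "invariant_filtration B P F"
begin

lemma subgroup_first: "subgroup (F 1) P"
  using term_subgroup[OF F] by simp

lemma term_subset_first: "i \<ge> 1 \<Longrightarrow> F i \<subseteq> F 1"
  using term_antimono[OF F] by simp

lemma term_in_first: "i \<ge> 1 \<Longrightarrow> x \<in> F i \<Longrightarrow> x \<in> F 1"
  using term_subset_first by blast

lemma scf_operation_sub_acted: "scf_operation B (sub_acted P F)"
proof -
  interpret S: group "sub_acted P F" using group_sub_acted subgroup_first .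
  have F1: "x \<in> F 1 \<Longrightarrow> x \<in> carrier P" for x by (rule term_carrier[OF F order_refl])
  have act_F1: "b \<in> carrier B \<Longrightarrow> x \<in> F 1 \<Longrightarrow> act P b x \<in> F 1" for b x
    by (rule term_act[OF F order_refl])
  show ?thesis
    by unfold_locales
      (simp_all del: One_nat_def add: scf_B F1 act_F1 act_mult act_one act_act
        subgroup.m_closed[OF subgroup_first])
qed

lemma invariant_filtration_sub_acted: "invariant_filtration B (sub_acted P F) F"
proof -
  have "subgroup (F i) (sub_acted P F)" if "i \<ge> 1" for i
    using subgroup_sub_acted[where F = F, OF subgroup_first term_subgroup[OF F that] term_subset_first[OF that]] .
  then show ?thesis
    using F term_in_first inv_sub_acted[where F = F, OF subgroup_first]
    unfolding invariant_filtration_def by simp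
qed

lemma pt_obj_sub_acted:
  assumes "centrally_moved B P F"
  shows "pt_obj B (sub_acted P F)"
proof -
  have "centrally_moved B (sub_acted P F) F"
    using assms term_in_first inv_sub_acted[where F = F, OF subgroup_first]
    unfolding centrally_moved_def by simp
  then show ?thesis
    using scf_operation_sub_acted invariant_filtration_sub_acted
    by (simp add: pt_obj_iff[OF scf_B])
qed

lemma t_filt_sub_acted:
  assumes i: "i \<ge> 1"
  shows "t_filt B (sub_acted P F) i = central_part F i"
proof -
  have "act_commutators (sub_acted P F) (filt B j) {g} \<subseteq> F (i + j) \<longleftrightarrow>
      (\<forall>b\<in>filt B j. act P b g \<otimes> inv g \<in> F (i + j))" if g: "g \<in> F i" for j g
    using term_in_first[OF i g] inv_sub_acted[where F = F, OF subgroup_first]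
    unfolding act_commutators_def by auto
  then show ?thesis unfolding t_filt_def central_part_def by auto
qed

end

lemma centrally_moved_if_pt_obj_sub_acted:
  assumes "subgroup (F 1) P" "pt_obj B (sub_acted P F)"
  shows "centrally_moved B P F"
proof -
  have S: "invariant_filtration B (sub_acted P F) F" "centrally_moved B (sub_acted P F) F"
    using assms(2) pt_obj_iff[OF scf_B, of "sub_acted P F"] by simp_all
  have "F i \<subseteq> F 1" if "i \<ge> 1" for i
    using S(1) that subgroup.subset[of "F i" "sub_acted P F"]
    by (simp add: invariant_filtration_def)
  then have "x \<in> F 1" if "i \<ge> 1" "x \<in> F i" for i x using that by blast
  then show ?thesis
    using S(2) inv_sub_acted[where F = F, OF assms(1)] unfolding centrally_moved_def by simp
qed

text \<open>
  The hypothesis \<open>sub_acted P (filt P) = P\<close> says that \<open>filt P 1\<close> is all of \<open>P\<close> and that \<open>act P\<close>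
  is extensional even outside \<open>carrier B\<close>; it makes the iteration start at a
  \<^const>\<open>sub_acted\<close>, so that each stage is a filtration inside one and the same group \<open>P\<close>.
\<close>

context
  assumes sub_filt: "sub_acted P (filt P) = P"
    and inv_filt_P: "invariant_filtration B P (filt P)"
begin

lemma t_iter_Suc: "t_iter B P (Suc l) = sub_acted (t_iter B P l) (t_filt B (t_iter B P l))"
  by (simp add: t_iter_def)

lemma t_iter_step:
  assumes "invariant_filtration B P F" "t_iter B P l = sub_acted P F"
  shows "t_iter B P (Suc l) = sub_acted P (t_filt B (t_iter B P l))"
    and "invariant_filtration B P (t_filt B (t_iter B P l))"
proof -
  have eq: "t_filt B (t_iter B P l) i = central_part F i" if "i \<ge> 1" for i
    using t_filt_sub_acted[OF assms(1) that] assms(2) by simp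
  then have "t_filt B (t_iter B P l) 1 \<subseteq> F 1"
    unfolding central_part_def by auto
  then show "t_iter B P (Suc l) = sub_acted P (t_filt B (t_iter B P l))"
    unfolding t_iter_Suc assms(2) by (rule sub_acted_sub_acted)
  show "invariant_filtration B P (t_filt B (t_iter B P l))"
    using invariant_filtration_central_part[OF assms(1)] eq
      invariant_filtration_cong[of "t_filt B (t_iter B P l)" "central_part F"] by blast
qed

lemma t_iter_invariant:
  "invariant_filtration B P (filt (t_iter B P l)) \<and>
   t_iter B P l = sub_acted P (filt (t_iter B P l))"
proof (induction l)
  case 0
  then show ?case using inv_filt_P sub_filt by (simp add: t_iter_def)
next
  case (Suc l)
  note step = t_iter_step[OF conjunct1[OF Suc] conjunct2[OF Suc]]
  have "filt (t_iter B P (Suc l)) = t_filt B (t_iter B P l)"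
    unfolding step(1) by simp
  then show ?case using step by simp
qed

lemma filt_t_iter_Suc:
  assumes "i \<ge> 1"
  shows "filt (t_iter B P (Suc l)) i = central_part (filt (t_iter B P l)) i"
  using t_filt_sub_acted[OF conjunct1[OF t_iter_invariant[of l]] assms]
    conjunct2[OF t_iter_invariant[of l]]
  by (simp add: t_iter_Suc)

lemma invariant_filtration_t_inf: "invariant_filtration B P (t_inf B P)"
proof -
  have "t_inf B P = (\<lambda>i. \<Inter>l. filt (t_iter B P l) i)" by (auto simp: t_inf_def)
  then show ?thesis
    using invariant_filtration_Inter[of "\<lambda>l. filt (t_iter B P l)"] t_iter_invariant by simp
qed

lemma centrally_moved_t_inf: "centrally_moved B P (t_inf B P)"
proof -
  have "act P b x \<otimes> inv x \<in> filt (t_iter B P l) (i + j)"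
    if "i \<ge> 1" "j \<ge> 1" "b \<in> filt B j" "x \<in> t_inf B P i" for i j b x l
  proof -
    have "x \<in> filt (t_iter B P (Suc l)) i" using that by (auto simp: t_inf_def)
    then show ?thesis using that filt_t_iter_Suc[OF that(1)] by (simp add: central_part_def)
  qed
  then show ?thesis unfolding centrally_moved_def by (simp add: t_inf_def)
qed

lemma t_inf_subset_filt: "t_inf B P i \<subseteq> filt P i"
proof -
  have "t_inf B P i \<subseteq> filt (t_iter B P 0) i" unfolding t_inf_def by blast
  then show ?thesis by (simp add: t_iter_def)
qed

lemma induces_action_on_t_inf: "induces_action_on B P (t_inf B P)"
  using subgroup_first[OF invariant_filtration_t_inf] t_inf_subset_filt
    pt_obj_sub_acted[OF invariant_filtration_t_inf centrally_moved_t_inf]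
  by (simp add: induces_action_on_def)

text \<open>
  By induction on the stage, a centrally moved family that starts inside \<open>filt P\<close> stays inside
  every stage of the iteration, hence inside the limit.  Families of subsets are allowed so that the lemma applies to the image of a
  filtration under a map.
\<close>

lemma centrally_moved_subset_t_inf:
  assumes sub: "\<And>i. i \<ge> 1 \<Longrightarrow> F i \<subseteq> filt P i" and F: "centrally_moved B P F"
    and i: "i \<ge> 1"
  shows "F i \<subseteq> t_inf B P i"
proof -
  have "\<forall>i\<ge>1. F i \<subseteq> filt (t_iter B P l) i" for l
  proof (induction l)
    case 0
    then show ?case using sub by (simp add: t_iter_def)
  next
    case (Suc l)
    show ?case
    proof (intro allI impI subsetI)
      fix i x assume i: "1 \<le> i" and x: "x \<in> F i"
      have "act P b x \<otimes> inv x \<in> filt (t_iter B P l) (i + j)" if j: "j \<ge> 1" "b \<in> filt B j" for j b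
      proof -
        have "act P b x \<otimes> inv x \<in> F (i + j)"
          using F i x j unfolding centrally_moved_def by blast
        then show ?thesis using Suc i by (meson subsetD trans_le_add1)
      qed
      then show "x \<in> filt (t_iter B P (Suc l)) i"
        using Suc i x unfolding filt_t_iter_Suc[OF i] central_part_def by blast
    qed
  qed
  then show ?thesis using i unfolding t_inf_def by blast
qed

lemma induces_action_on_subset_t_inf:
  assumes "induces_action_on B P F" "i \<ge> 1"
  shows "F i \<subseteq> t_inf B P i"
  using assms centrally_moved_if_pt_obj_sub_acted[of F] centrally_moved_subset_t_inf[of F]
  unfolding induces_action_on_def by blast

end

end

section \<open>Restriction of operations\<close>

lemma scf_homD:
  assumes "f \<in> scf_hom G H"
  shows "f \<in> hom G H" "f \<in> extensional (carrier G)"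
    and "\<And>i x. i \<ge> 1 \<Longrightarrow> x \<in> filt G i \<Longrightarrow> f x \<in> filt H i"
    and "\<And>x. x \<in> carrier G \<Longrightarrow> f x \<in> carrier H"
    and "\<And>x y. x \<in> carrier G \<Longrightarrow> y \<in> carrier G \<Longrightarrow> f (x \<otimes>\<^bsub>G\<^esub> y) = f x \<otimes>\<^bsub>H\<^esub> f y"
  using assms unfolding scf_hom_def hom_def by blast+

lemma pt_homD:
  assumes "f \<in> pt_hom B P Q"
  shows "f \<in> scf_hom P Q"
    and "\<And>b x. b \<in> carrier B \<Longrightarrow> x \<in> carrier P \<Longrightarrow> f (act P b x) = act Q b (f x)"
  using assms unfolding pt_hom_def by blast+

lemma pt_hom_compose:
  assumes f: "f \<in> pt_hom B P Q" and g: "g \<in> pt_hom B Q R" and P: "pt_obj B P" and B: "scf B"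
  shows "compose (carrier P) g f \<in> pt_hom B P R"
proof -
  interpret scf_operation B P by (rule pt_objD(1)[OF B P])
  note f' = scf_homD[OF pt_homD(1)[OF f]] and g' = scf_homD[OF pt_homD(1)[OF g]]
  have filt: "x \<in> carrier P" if "i \<ge> 1" "x \<in> filt P i" for i x
    by (rule term_carrier[OF pt_objD(3)[OF B P] that])
  have "compose (carrier P) g f \<in> hom P R"
    by (rule homI) (simp_all add: compose_def f' g')
  moreover have "compose (carrier P) g f ` filt P i \<subseteq> filt R i" if "i \<ge> 1" for i
    using that filt f'(3) g'(3) by (auto simp: compose_def simp del: One_nat_def)
  ultimately show ?thesis
    using f'(4) pt_homD(2)[OF f] pt_homD(2)[OF g]
    by (simp add: pt_hom_def scf_hom_def compose_def act_closed)
qed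

lemma restr_simps [simp]:
  "carrier (restr \<alpha> P) = carrier P" "mult (restr \<alpha> P) = mult P" "one (restr \<alpha> P) = one P"
  "filt (restr \<alpha> P) = filt P" "act (restr \<alpha> P) e = act P (\<alpha> e)"
  by (simp_all add: restr_def)

lemma inv_restr [simp]: "inv\<^bsub>restr \<alpha> P\<^esub> x = inv\<^bsub>P\<^esub> x"
  by (simp add: m_inv_def)

lemma subgroup_restr [simp]: "subgroup S (restr \<alpha> P) \<longleftrightarrow> subgroup S P"
  by (simp add: subgroup_def)

lemma pt_obj_restr:
  assumes E: "scf E" and B: "scf B" and \<alpha>: "\<alpha> \<in> scf_hom E B" and P: "pt_obj B P"
  shows "pt_obj E (restr \<alpha> P)"
proof -
  interpret scf_operation B P by (rule pt_objD(1)[OF B P])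
  interpret E: group E using E by (simp add: scf_def)
  note \<alpha>' = scf_homD[OF \<alpha>]
  interpret \<alpha>: group_hom E B \<alpha>
    using \<alpha>'(1) by unfold_locales
  have P': "filt P 1 = carrier P" "invariant_filtration B P (filt P)" "centrally_moved B P (filt P)"
    using pt_objD(2-4)[OF B P] .
  interpret R: group "restr \<alpha> P"
  proof (rule groupI)
    fix x assume x: "x \<in> carrier (restr \<alpha> P)"
    then show "\<exists>y\<in>carrier (restr \<alpha> P). y \<otimes>\<^bsub>restr \<alpha> P\<^esub> x = \<one>\<^bsub>restr \<alpha> P\<^esub>"
      by (intro bexI[of _ "inv\<^bsub>P\<^esub> x"]) simp_all
  qed (simp_all add: m_assoc)
  have "scf_operation E (restr \<alpha> P)"
    by unfold_locales
      (simp_all add: E act_ext act_closed act_mult act_one act_act \<alpha>'(4,5))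
  moreover have "invariant_filtration E (restr \<alpha> P) (filt P)"
    using P'(2) \<alpha>'(4) by (simp add: invariant_filtration_def)
  moreover have "centrally_moved E (restr \<alpha> P) (filt P)"
    using P'(3) \<alpha>'(3) by (simp add: centrally_moved_def)
  ultimately show ?thesis using P'(1) by (simp add: pt_obj_iff[OF E])
qed

lemma pt_hom_restr:
  assumes "\<alpha> \<in> scf_hom E B" "h \<in> pt_hom B P P'"
  shows "h \<in> pt_hom E (restr \<alpha> P) (restr \<alpha> P')"
  using assms(2) scf_homD(4)[OF assms(1)] by (simp add: pt_hom_def scf_hom_def hom_def)

section \<open>Equivariant maps\<close>

lemma equivariant_maps_iff:
  "u \<in> equivariant_maps E B \<alpha> Y S \<longleftrightarrow>
     u \<in> extensional (carrier B) \<and> (\<forall>x\<in>carrier B. u x \<in> S) \<and>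
     (\<forall>e\<in>carrier E. \<forall>x\<in>carrier B. u (\<alpha> e \<otimes>\<^bsub>B\<^esub> x) = act Y e (u x))"
  by (auto simp: equivariant_maps_def PiE_iff)

lemma hom_acted_simps:
  "carrier (hom_acted E B \<alpha> Y) = equivariant_maps E B \<alpha> Y (carrier Y)"
  "u \<otimes>\<^bsub>hom_acted E B \<alpha> Y\<^esub> v = (\<lambda>x\<in>carrier B. u x \<otimes>\<^bsub>Y\<^esub> v x)"
  "\<one>\<^bsub>hom_acted E B \<alpha> Y\<^esub> = (\<lambda>x\<in>carrier B. \<one>\<^bsub>Y\<^esub>)"
  "filt (hom_acted E B \<alpha> Y) i = equivariant_maps E B \<alpha> Y (filt Y i)"
  "act (hom_acted E B \<alpha> Y) b =
     (\<lambda>u\<in>equivariant_maps E B \<alpha> Y (carrier Y). \<lambda>x\<in>carrier B. u (x \<otimes>\<^bsub>B\<^esub> b))"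
  by (simp_all add: hom_acted_def)

locale coinduction =
  fixes E :: "'e filtered" and B :: "'b filtered" and \<alpha> :: "'e \<Rightarrow> 'b" and Y :: "('y, 'e) acted"
  assumes scf_E: "scf E" and scf_B: "scf B" and \<alpha>_hom: "\<alpha> \<in> scf_hom E B" and pt_Y: "pt_obj E Y"
begin

abbreviation maps :: "'y set \<Rightarrow> ('b \<Rightarrow> 'y) set" where
  "maps \<equiv> equivariant_maps E B \<alpha> Y"

abbreviation H :: "('b \<Rightarrow> 'y, 'b) acted" where
  "H \<equiv> hom_acted E B \<alpha> Y"

abbreviation C :: "('b \<Rightarrow> 'y, 'b) acted" where
  "C \<equiv> coind E B \<alpha> Y"

end

sublocale coinduction \<subseteq> B: group B
  using scf_B by (simp add: scf_def)

sublocale coinduction \<subseteq> Y: scf_operation E Y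
  by (rule pt_objD(1)[OF scf_E pt_Y])

context coinduction
begin

lemmas \<alpha>_closed = scf_homD(4)[OF \<alpha>_hom]

lemma filt_Y: "invariant_filtration E Y (filt Y)" "filt Y 1 = carrier Y"
  using pt_objD(2,3)[OF scf_E pt_Y] by simp_all

lemma maps_mono: "S \<subseteq> T \<Longrightarrow> maps S \<subseteq> maps T"
  by (rule subsetI) (simp add: equivariant_maps_iff subset_iff)

lemma maps_mult:
  assumes S: "subgroup S Y" and "u \<in> maps S" "v \<in> maps S"
  shows "(\<lambda>x\<in>carrier B. u x \<otimes>\<^bsub>Y\<^esub> v x) \<in> maps S"
  using assms(2,3) subgroup.m_closed[OF S] subgroup.mem_carrier[OF S]
  by (simp add: equivariant_maps_iff Y.act_mult \<alpha>_closed)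

lemma maps_one:
  assumes S: "subgroup S Y"
  shows "(\<lambda>x\<in>carrier B. \<one>\<^bsub>Y\<^esub>) \<in> maps S"
proof -
  have "act Y e \<one>\<^bsub>Y\<^esub> = \<one>\<^bsub>Y\<^esub>" if "e \<in> carrier E" for e
    using Y.act_mult[of e "\<one>\<^bsub>Y\<^esub>" "\<one>\<^bsub>Y\<^esub>"] Y.act_closed[of e "\<one>\<^bsub>Y\<^esub>"] that by simp
  then show ?thesis
    using subgroup.one_closed[OF S] by (simp add: equivariant_maps_iff \<alpha>_closed)
qed

lemma maps_inv:
  assumes S: "subgroup S Y" and "u \<in> maps S"
  shows "(\<lambda>x\<in>carrier B. inv\<^bsub>Y\<^esub> (u x)) \<in> maps S"
  using assms(2) subgroup.m_inv_closed[OF S] subgroup.mem_carrier[OF S]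
  by (simp add: equivariant_maps_iff Y.act_inv \<alpha>_closed)

lemma maps_translate:
  assumes "u \<in> maps S" "b \<in> carrier B"
  shows "(\<lambda>x\<in>carrier B. u (x \<otimes>\<^bsub>B\<^esub> b)) \<in> maps S"
  using assms by (simp add: equivariant_maps_iff \<alpha>_closed B.m_assoc)

lemma maps_closed: "u \<in> maps S \<Longrightarrow> x \<in> carrier B \<Longrightarrow> u x \<in> S"
  by (simp add: equivariant_maps_iff)

lemma maps_extensional: "u \<in> maps S \<Longrightarrow> u \<in> extensional (carrier B)"
  by (simp add: equivariant_maps_iff)

lemma group_H: "group H"
proof (rule groupI)
  fix u assume u: "u \<in> carrier H"
  then have uc: "x \<in> carrier B \<Longrightarrow> u x \<in> carrier Y" for x
    by (simp add: hom_acted_simps maps_closed)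
  have "(\<lambda>x\<in>carrier B. inv\<^bsub>Y\<^esub> (u x)) \<in> carrier H"
    using u maps_inv[OF Y.subgroup_self] by (simp add: hom_acted_simps)
  then show "\<exists>v\<in>carrier H. v \<otimes>\<^bsub>H\<^esub> u = \<one>\<^bsub>H\<^esub>"
    by (rule bexI[rotated]) (auto simp: hom_acted_simps uc intro!: restrict_ext)
  show "\<one>\<^bsub>H\<^esub> \<otimes>\<^bsub>H\<^esub> u = u"
    using u by (intro extensionalityI[where A = "carrier B"]) (simp_all add: hom_acted_simps uc maps_extensional)
next
  fix u v w assume "u \<in> carrier H" "v \<in> carrier H" "w \<in> carrier H"
  then show "u \<otimes>\<^bsub>H\<^esub> v \<otimes>\<^bsub>H\<^esub> w = u \<otimes>\<^bsub>H\<^esub> (v \<otimes>\<^bsub>H\<^esub> w)"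
    by (auto simp: hom_acted_simps maps_closed Y.m_assoc intro!: restrict_ext)
qed (simp_all add: hom_acted_simps maps_mult maps_one Y.subgroup_self)

lemma inv_H:
  assumes "u \<in> maps (carrier Y)"
  shows "inv\<^bsub>H\<^esub> u = (\<lambda>x\<in>carrier B. inv\<^bsub>Y\<^esub> (u x))"
proof (rule group.inv_equality[OF group_H])
  show "(\<lambda>x\<in>carrier B. inv\<^bsub>Y\<^esub> (u x)) \<otimes>\<^bsub>H\<^esub> u = \<one>\<^bsub>H\<^esub>"
    using assms by (auto simp: hom_acted_simps maps_closed intro!: restrict_ext)
qed (use assms maps_inv[OF Y.subgroup_self] in \<open>simp_all add: hom_acted_simps\<close>)

lemma scf_operation_H: "scf_operation B H"
proof -
  interpret H: group H by (rule group_H)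
  show ?thesis
  proof
    show "scf B" by (rule scf_B)
  next
    fix b u v assume b: "b \<in> carrier B" and uv: "u \<in> carrier H" "v \<in> carrier H"
    have "u \<otimes>\<^bsub>H\<^esub> v \<in> carrier H" using uv by simp
    then show "act H b (u \<otimes>\<^bsub>H\<^esub> v) = act H b u \<otimes>\<^bsub>H\<^esub> act H b v"
      using b uv by (auto simp: hom_acted_simps intro!: restrict_ext)
  next
    fix u assume "u \<in> carrier H"
    then show "act H \<one>\<^bsub>B\<^esub> u = u"
      by (intro extensionalityI[where A = "carrier B"]) (simp_all add: hom_acted_simps maps_extensional)
  next
    fix b c u assume "b \<in> carrier B" "c \<in> carrier B" "u \<in> carrier H"
    then show "act H (b \<otimes>\<^bsub>B\<^esub> c) u = act H b (act H c u)"
      using maps_translate[of u "carrier Y" c]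
      by (auto simp: hom_acted_simps B.m_assoc intro!: restrict_ext)
  qed (simp_all add: hom_acted_simps maps_translate)
qed

end

sublocale coinduction \<subseteq> H: scf_operation B "hom_acted E B \<alpha> Y"
  by (rule scf_operation_H)

context coinduction
begin

lemma filt_H_subset: "i \<ge> 1 \<Longrightarrow> maps (filt Y i) \<subseteq> maps (carrier Y)"
  using Y.term_carrier[OF filt_Y(1)] by (intro maps_mono) blast

lemma invariant_filtration_H: "invariant_filtration B H (filt H)"
  unfolding invariant_filtration_def
proof (intro conjI allI impI ballI)
  fix i :: nat assume i: "1 \<le> i"
  note S = Y.term_subgroup[OF filt_Y(1) i]
  have sub: "u \<in> maps (carrier Y)" if "u \<in> maps (filt Y i)" for u
    using filt_H_subset[OF i] that by blast
  show "subgroup (filt H i) H"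
    by (rule subgroup.intro)
      (use S sub in \<open>auto simp: hom_acted_simps maps_mult maps_one maps_inv inv_H\<close>)
  have "filt Y (Suc i) \<subseteq> filt Y i" using Y.term_antimono[OF filt_Y(1) i, of "Suc i"] by simp
  then show "filt H (Suc i) \<subseteq> filt H i" by (simp add: hom_acted_simps maps_mono)
  show "act H b u \<in> filt H i" if "b \<in> carrier B" "u \<in> filt H i" for b u
    using that sub by (simp add: hom_acted_simps maps_translate)
  fix j u v assume j: "1 \<le> j" and u: "u \<in> filt H i" and v: "v \<in> filt H j"
  have uv: "u \<in> maps (carrier Y)" "v \<in> maps (carrier Y)"
    using u v filt_H_subset[OF i] filt_H_subset[OF j] by (auto simp: hom_acted_simps)
  let ?c = "u \<otimes>\<^bsub>H\<^esub> v \<otimes>\<^bsub>H\<^esub> inv\<^bsub>H\<^esub> u \<otimes>\<^bsub>H\<^esub> inv\<^bsub>H\<^esub> v"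
  have "?c \<in> carrier H" using uv by (simp add: hom_acted_simps(1)[symmetric])
  moreover have "?c x \<in> filt Y (i + j)" if x: "x \<in> carrier B" for x
    using Y.term_commutator[OF filt_Y(1) i j, of "u x" "v x"] x u v
    by (simp add: hom_acted_simps inv_H uv maps_closed)
  ultimately show "?c \<in> filt H (i + j)"
    unfolding hom_acted_simps(1,4) equivariant_maps_iff by blast
qed

lemma sub_acted_filt_H: "sub_acted H (filt H) = H"
  using filt_Y(2) by (simp add: sub_acted_def hom_acted_def)

lemmas H_t_inf = H.invariant_filtration_t_inf[OF sub_acted_filt_H invariant_filtration_H]

section \<open>Co-induction as a right adjoint\<close>

lemma coind_simps:
  "carrier C = t_inf B H 1" "filt C = t_inf B H" "mult C = mult H" "one C = one H"
  "act C b = restrict (act H b) (t_inf B H 1)"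
  by (simp_all add: coind_def)

lemma pt_obj_coind: "pt_obj B C"
  using H.induces_action_on_t_inf[OF sub_acted_filt_H invariant_filtration_H]
  by (simp add: induces_action_on_def coind_def)

lemma filt_coind_maps: "u \<in> filt C i \<Longrightarrow> u \<in> maps (filt Y i)"
  using H.t_inf_subset_filt[OF sub_acted_filt_H invariant_filtration_H, of i]
  by (auto simp: coind_simps hom_acted_simps)

lemma carrier_coind_maps: "u \<in> carrier C \<Longrightarrow> u \<in> maps (carrier Y)"
  using filt_coind_maps[of u 1] by (simp only: coind_simps(1,2) filt_Y(2))

lemma act_coind:
  assumes "b \<in> carrier B" "u \<in> carrier C" "x \<in> carrier B"
  shows "act C b u x = u (x \<otimes>\<^bsub>B\<^esub> b)"
  using assms carrier_coind_maps[OF assms(2)] by (simp add: coind_simps hom_acted_simps)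

lemma filt_coind_carrier: "i \<ge> 1 \<Longrightarrow> u \<in> filt C i \<Longrightarrow> u \<in> carrier C"
  using H.term_antimono[OF H_t_inf, of 1 i] by (auto simp: coind_simps)

lemma coind_counit_hom: "coind_counit E B \<alpha> Y \<in> pt_hom E (restr \<alpha> C) Y"
proof -
  interpret C: scf_operation B C by (rule pt_objD(1)[OF scf_B pt_obj_coind])
  have "coind_counit E B \<alpha> Y \<in> hom (restr \<alpha> C) Y"
  proof (rule homI)
    fix u v assume "u \<in> carrier (restr \<alpha> C)" "v \<in> carrier (restr \<alpha> C)"
    moreover from this have "u \<otimes>\<^bsub>C\<^esub> v \<in> carrier C" by simp
    ultimately show "coind_counit E B \<alpha> Y (u \<otimes>\<^bsub>restr \<alpha> C\<^esub> v) =
        coind_counit E B \<alpha> Y u \<otimes>\<^bsub>Y\<^esub> coind_counit E B \<alpha> Y v"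
      by (simp add: coind_counit_def) (simp add: coind_simps hom_acted_simps)
  qed (simp add: coind_counit_def maps_closed[OF carrier_coind_maps])
  moreover have "coind_counit E B \<alpha> Y u \<in> filt Y i" if "i \<ge> 1" "u \<in> filt C i" for i u
    using that filt_coind_carrier maps_closed[OF filt_coind_maps, of u i "\<one>\<^bsub>B\<^esub>"]
    by (simp add: coind_counit_def)
  moreover have "coind_counit E B \<alpha> Y (act C (\<alpha> e) u) = act Y e (coind_counit E B \<alpha> Y u)"
    if e: "e \<in> carrier E" and u: "u \<in> carrier C" for e u
  proof -
    have \<alpha>e: "\<alpha> e \<in> carrier B" using e by (rule \<alpha>_closed)
    have "coind_counit E B \<alpha> Y (act C (\<alpha> e) u) = u (\<alpha> e \<otimes>\<^bsub>B\<^esub> \<one>\<^bsub>B\<^esub>)"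
      using \<alpha>e u by (simp add: coind_counit_def C.act_closed act_coind)
    \<comment> \<open>The right translation by \<open>\<alpha> e\<close> is a left translation at the unit, where equivariance applies.\<close>
    also have "\<dots> = act Y e (u \<one>\<^bsub>B\<^esub>)"
      using carrier_coind_maps[OF u] e B.one_closed unfolding equivariant_maps_iff by blast
    finally show ?thesis using u by (simp add: coind_counit_def)
  qed
  ultimately show ?thesis
    by (auto simp: pt_hom_def scf_hom_def) (simp add: coind_counit_def)
qed

end

text \<open>
  The inverse of the adjunction map: \<open>f\<close> is spread along the orbits of \<open>B\<^sub>1\<close>.
\<close>

definition coind_transpose ::
  "'b filtered \<Rightarrow> ('x, 'b) acted \<Rightarrow> ('x \<Rightarrow> 'y) \<Rightarrow> 'x \<Rightarrow> 'b \<Rightarrow> 'y" where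
  "coind_transpose B P f = (\<lambda>p\<in>carrier P. \<lambda>x\<in>carrier B. f (act P x p))"

context coinduction
begin

text \<open>
  The transpose of \<open>f\<close> lands in the limit \<open>t\<^sup>\<infinity>\<close>: it commutes with \<open>B\<close>, so the images of the
  terms of \<open>P\<close> are centrally moved by \<open>B\<close> because those terms are.
\<close>

lemma coind_transpose_hom:
  assumes P: "pt_obj B P" and f: "f \<in> pt_hom E (restr \<alpha> P) Y"
  shows "coind_transpose B P f \<in> pt_hom B P C"
proof -
  interpret P: scf_operation B P by (rule pt_objD(1)[OF scf_B P])
  have filt_P: "invariant_filtration B P (filt P)" "centrally_moved B P (filt P)"
      "filt P 1 = carrier P"
    using pt_objD(2-4)[OF scf_B P] by simp_all
  note filt_carrier = P.term_carrier[OF filt_P(1)]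
  note f' = scf_homD[OF pt_homD(1)[OF f], simplified restr_simps]
  have f_act: "f (act P (\<alpha> e) p) = act Y e (f p)" if "e \<in> carrier E" "p \<in> carrier P" for e p
    using pt_homD(2)[OF f, of e p] that by simp
  let ?g = "coind_transpose B P f"
  have g_app: "?g p x = f (act P x p)" if "p \<in> carrier P" "x \<in> carrier B" for p x
    using that by (simp add: coind_transpose_def)
  have g_ext: "?g p \<in> extensional (carrier B)" if "p \<in> carrier P" for p
    using that by (simp add: coind_transpose_def)
  have g_maps: "?g p \<in> maps (filt Y i)" if i: "i \<ge> 1" and p: "p \<in> filt P i" for i p
    using filt_carrier[OF i p] P.term_act[OF filt_P(1) i _ p] f'(3)[OF i]
    by (simp add: equivariant_maps_iff g_ext g_app f_act P.act_act P.act_closed \<alpha>_closed)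
  have g_closed: "?g p \<in> maps (carrier Y)" if p: "p \<in> carrier P" for p
    using g_maps[of 1 p] p by (simp only: filt_P(3) filt_Y(2) order_refl)
  have "?g \<in> hom P H"
  proof (rule homI)
    fix p q assume pq: "p \<in> carrier P" "q \<in> carrier P"
    have "?g (p \<otimes>\<^bsub>P\<^esub> q) \<in> extensional (carrier B)" using pq by (simp add: g_ext)
    then show "?g (p \<otimes>\<^bsub>P\<^esub> q) = ?g p \<otimes>\<^bsub>H\<^esub> ?g q"
      by (rule extensionalityI)
        (simp_all add: hom_acted_simps g_app pq P.act_mult P.act_closed f'(5))
  qed (simp add: hom_acted_simps g_closed)
  then interpret g: group_hom P H ?g by unfold_locales
  have g_act: "?g (act P b p) = act H b (?g p)" if b: "b \<in> carrier B" and p: "p \<in> carrier P" for b p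
  proof -
    have "?g (act P b p) \<in> extensional (carrier B)" using b p by (simp add: g_ext P.act_closed)
    then show ?thesis
      by (rule extensionalityI)
        (simp_all add: hom_acted_simps g_closed g_app b p P.act_act P.act_closed)
  qed
  have "centrally_moved B H (\<lambda>i. ?g ` filt P i)"
    unfolding centrally_moved_def
  proof (intro allI impI ballI)
    fix i j b u assume i: "1 \<le> i" and j: "1 \<le> j" and b: "b \<in> filt B j" and "u \<in> ?g ` filt P i"
    then obtain p where p: "p \<in> filt P i" "u = ?g p" by blast
    note pc = filt_carrier[OF i p(1)] and bc = H.filt_B[OF j b]
    have "act H b u \<otimes>\<^bsub>H\<^esub> inv\<^bsub>H\<^esub> u = ?g (act P b p \<otimes>\<^bsub>P\<^esub> inv\<^bsub>P\<^esub> p)"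
      using pc bc p(2) by (simp add: g_act P.act_closed)
    moreover have "act P b p \<otimes>\<^bsub>P\<^esub> inv\<^bsub>P\<^esub> p \<in> filt P (i + j)"
      using filt_P(2) i j b p(1) unfolding centrally_moved_def by blast
    ultimately show "act H b u \<otimes>\<^bsub>H\<^esub> inv\<^bsub>H\<^esub> u \<in> ?g ` filt P (i + j)" by blast
  qed
  moreover have "?g ` filt P i \<subseteq> filt H i" if "i \<ge> 1" for i
    using g_maps[OF that] by (auto simp: hom_acted_simps)
  ultimately have g_filt: "?g ` filt P i \<subseteq> t_inf B H i" if "i \<ge> 1" for i
    using H.centrally_moved_subset_t_inf[OF sub_acted_filt_H invariant_filtration_H,
        of "\<lambda>i. ?g ` filt P i"] that by blast
  have g_first: "?g p \<in> t_inf B H 1" if "p \<in> carrier P" for p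
    using g_filt[OF order_refl] that unfolding filt_P(3) by blast
  have "?g \<in> hom P C"
    by (rule homI) (simp_all only: coind_simps g_first g.hom_mult)
  then show ?thesis
    using g_filt g_first g_act
    by (simp add: pt_hom_def scf_hom_def coind_simps coind_transpose_def[of B P f])
qed

lemma coind_adj_apply:
  assumes "g \<in> pt_hom B P C" "p \<in> carrier P"
  shows "coind_adj E B \<alpha> P Y g p = g p \<one>\<^bsub>B\<^esub>"
  using assms scf_homD(4)[OF pt_homD(1)[OF assms(1)]]
  by (simp add: coind_adj_def coind_counit_def compose_def)

text \<open>
  An equivariant \<open>g\<close> is recovered from its values at the unit, since
  \<open>g p x = (x \<cdot> g p) 1 = g (x \<cdot> p) 1\<close>.
\<close>

lemma coind_adj_bij:
  assumes P: "pt_obj B P"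
  shows "bij_betw (coind_adj E B \<alpha> P Y) (pt_hom B P C) (pt_hom E (restr \<alpha> P) Y)"
proof (rule bij_betw_byWitness[where f' = "coind_transpose B P"])
  interpret P: scf_operation B P by (rule pt_objD(1)[OF scf_B P])
  show "\<forall>g\<in>pt_hom B P C. coind_transpose B P (coind_adj E B \<alpha> P Y g) = g"
  proof
    fix g assume g: "g \<in> pt_hom B P C"
    note g' = scf_homD[OF pt_homD(1)[OF g]]
    show "coind_transpose B P (coind_adj E B \<alpha> P Y g) = g"
    proof (rule extensionalityI[OF _ g'(2)])
      fix p assume p: "p \<in> carrier P"
      have "g p \<in> extensional (carrier B)"
        using p by (intro maps_extensional[OF carrier_coind_maps] g'(4))
      then show "coind_transpose B P (coind_adj E B \<alpha> P Y g) p = g p"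
        using p g'(4)
        by (intro extensionalityI[where A = "carrier B"]) (simp_all add: coind_transpose_def coind_adj_apply[OF g]
            P.act_closed pt_homD(2)[OF g] act_coind)
    qed (simp add: coind_transpose_def)
  qed
  show "\<forall>f\<in>pt_hom E (restr \<alpha> P) Y. coind_adj E B \<alpha> P Y (coind_transpose B P f) = f"
  proof
    fix f assume f: "f \<in> pt_hom E (restr \<alpha> P) Y"
    have "f \<in> extensional (carrier P)" using scf_homD(2)[OF pt_homD(1)[OF f]] by simp
    moreover have "coind_adj E B \<alpha> P Y (coind_transpose B P f) \<in> extensional (carrier P)"
      by (simp add: coind_adj_def)
    ultimately show "coind_adj E B \<alpha> P Y (coind_transpose B P f) = f"
      using coind_transpose_hom[OF P f]
      by (intro extensionalityI)
        (auto simp: coind_adj_apply coind_transpose_def P.act_one)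
  qed
  show "coind_adj E B \<alpha> P Y ` pt_hom B P C \<subseteq> pt_hom E (restr \<alpha> P) Y"
  proof clarify
    fix g assume "g \<in> pt_hom B P C"
    from pt_hom_compose[OF pt_hom_restr[OF \<alpha>_hom this] coind_counit_hom
        pt_obj_restr[OF scf_E scf_B \<alpha>_hom P] scf_E]
    show "coind_adj E B \<alpha> P Y g \<in> pt_hom E (restr \<alpha> P) Y" by (simp add: coind_adj_def)
  qed
  show "coind_transpose B P ` pt_hom E (restr \<alpha> P) Y \<subseteq> pt_hom B P C"
    using coind_transpose_hom[OF P] by blast
qed

lemma coind_map_apply:
  assumes "u \<in> carrier C" "x \<in> carrier B"
  shows "coind_map E B \<alpha> Y k u x = k (u x)"
  using assms by (simp add: coind_map_def compose_def)

lemma coind_map_extensional: "coind_map E B \<alpha> Y k \<in> extensional (carrier C)"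
  by (simp add: coind_map_def)

text \<open>
  Post-composition with \<open>k\<close> is the transpose of \<open>k\<close> after the counit, which makes it a morphism
  without a second verification.
\<close>

lemma coind_map_eq_transpose:
  "coind_map E B \<alpha> Y k = coind_transpose B C (compose (carrier C) k (coind_counit E B \<alpha> Y))"
proof -
  interpret C: scf_operation B C by (rule pt_objD(1)[OF scf_B pt_obj_coind])
  show ?thesis
  proof (rule extensionalityI[OF coind_map_extensional])
    fix u assume u: "u \<in> carrier C"
    have "compose (carrier C) k (coind_counit E B \<alpha> Y) (act C x u) = k (u x)"
      if "x \<in> carrier B" for x
      using that u by (simp add: compose_def coind_counit_def C.act_closed act_coind)
    then show "coind_map E B \<alpha> Y k u =
        coind_transpose B C (compose (carrier C) k (coind_counit E B \<alpha> Y)) u"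
      using u by (auto simp: coind_map_def coind_transpose_def compose_def intro!: restrict_ext)
  qed (simp add: coind_transpose_def)
qed

lemma coind_map_id:
  "coind_map E B \<alpha> Y (\<lambda>y\<in>carrier Y. y) = (\<lambda>u\<in>carrier C. u)"
proof (rule extensionalityI[OF coind_map_extensional])
  fix u assume u: "u \<in> carrier C"
  note um = carrier_coind_maps[OF u]
  show "coind_map E B \<alpha> Y (\<lambda>y\<in>carrier Y. y) u = (\<lambda>u\<in>carrier C. u) u"
    using u um
    by (intro extensionalityI[where A = "carrier B"]) (simp_all add: coind_map_apply maps_closed maps_extensional
        coind_map_def compose_extensional)
qed simp

end

lemma coind_map_hom:
  assumes "coinduction E B \<alpha> Y" "coinduction E B \<alpha> Y'" and k: "k \<in> pt_hom E Y Y'"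
  shows "coind_map E B \<alpha> Y k \<in> pt_hom B (coind E B \<alpha> Y) (coind E B \<alpha> Y')"
proof -
  interpret coinduction E B \<alpha> Y by fact
  interpret Y': coinduction E B \<alpha> Y' by fact
  have "compose (carrier C) k (coind_counit E B \<alpha> Y) \<in> pt_hom E (restr \<alpha> C) Y'"
    using pt_hom_compose[OF coind_counit_hom k
        pt_obj_restr[OF scf_E scf_B \<alpha>_hom pt_obj_coind] scf_E] by simp
  then show ?thesis
    unfolding coind_map_eq_transpose by (rule Y'.coind_transpose_hom[OF pt_obj_coind])
qed

lemma coind_map_compose:
  assumes "coinduction E B \<alpha> Y" "coinduction E B \<alpha> Y'" and k: "k \<in> pt_hom E Y Y'"
  shows "coind_map E B \<alpha> Y (compose (carrier Y) k' k) =
    compose (carrier (coind E B \<alpha> Y)) (coind_map E B \<alpha> Y' k') (coind_map E B \<alpha> Y k)"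
proof -
  interpret coinduction E B \<alpha> Y by fact
  interpret Y': coinduction E B \<alpha> Y' by fact
  show ?thesis
  proof (rule extensionalityI[OF coind_map_extensional])
    fix u assume u: "u \<in> carrier C"
    then have ku: "coind_map E B \<alpha> Y k u \<in> carrier Y'.C"
      using scf_homD(4)[OF pt_homD(1)[OF coind_map_hom[OF assms]]] by blast
    show "coind_map E B \<alpha> Y (compose (carrier Y) k' k) u =
        compose (carrier C) (coind_map E B \<alpha> Y' k') (coind_map E B \<alpha> Y k) u"
      using u ku maps_closed[OF carrier_coind_maps[OF u]]
      by (auto simp: coind_map_def compose_def intro!: restrict_ext)
  qed simp
qed

lemma coind_adj_natural_left:
  assumes h: "h \<in> pt_hom B P' P"
  shows "coind_adj E B \<alpha> P' Y (compose (carrier P') g h) =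
    compose (carrier P') (coind_adj E B \<alpha> P Y g) h"
  using scf_homD(4)[OF pt_homD(1)[OF h]]
  by (auto simp: coind_adj_def compose_def intro!: restrict_ext)

lemma coind_adj_natural_right:
  assumes "coinduction E B \<alpha> Y" "coinduction E B \<alpha> Y'"
    and k: "k \<in> pt_hom E Y Y'" and g: "g \<in> pt_hom B P (coind E B \<alpha> Y)"
  shows "coind_adj E B \<alpha> P Y' (compose (carrier P) (coind_map E B \<alpha> Y k) g) =
    compose (carrier P) k (coind_adj E B \<alpha> P Y g)"
proof -
  interpret coinduction E B \<alpha> Y by fact
  have "g p \<in> carrier C" if "p \<in> carrier P" for p
    using scf_homD(4)[OF pt_homD(1)[OF g]] that by blast
  moreover have "coind_map E B \<alpha> Y k u \<in> carrier (coind E B \<alpha> Y')" if "u \<in> carrier C" for u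
    using scf_homD(4)[OF pt_homD(1)[OF coind_map_hom[OF assms(1-3)]]] that by blast
  ultimately show ?thesis
    by (auto simp: coind_adj_def compose_def coind_counit_def coind_map_apply
        intro!: restrict_ext)
qed

theorem theorem2p1:
  fixes E :: "'e filtered" and B :: "'b filtered" and \<alpha> :: "'e \<Rightarrow> 'b"
  assumes "scf E" and "scf B" and "\<alpha> \<in> scf_hom E B"
  shows
    "((\<forall>P :: ('x, 'b) acted. pt_obj B P \<longrightarrow> pt_obj E (restr \<alpha> P)) \<and>
     (\<forall>(P :: ('x, 'b) acted) (P' :: ('x1, 'b) acted) h.
        pt_obj B P \<and> pt_obj B P' \<and> h \<in> pt_hom B P P' \<longrightarrow>
        h \<in> pt_hom E (restr \<alpha> P) (restr \<alpha> P'))) \<and>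
     ((\<forall>Y :: ('y, 'e) acted. pt_obj E Y \<longrightarrow> pt_obj B (coind E B \<alpha> Y)) \<and>
     (\<forall>(Y :: ('y, 'e) acted) (Y' :: ('y1, 'e) acted) k.
        pt_obj E Y \<and> pt_obj E Y' \<and> k \<in> pt_hom E Y Y' \<longrightarrow>
        coind_map E B \<alpha> Y k \<in> pt_hom B (coind E B \<alpha> Y) (coind E B \<alpha> Y')) \<and>
     (\<forall>Y :: ('y, 'e) acted. pt_obj E Y \<longrightarrow>
        coind_map E B \<alpha> Y (\<lambda>y\<in>carrier Y. y) = (\<lambda>u\<in>carrier (coind E B \<alpha> Y). u)) \<and>
     (\<forall>(Y :: ('y, 'e) acted) (Y' :: ('y1, 'e) acted) (Y'' :: ('y2, 'e) acted) k k'.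
        pt_obj E Y \<and> pt_obj E Y' \<and> pt_obj E Y'' \<and> k \<in> pt_hom E Y Y' \<and> k' \<in> pt_hom E Y' Y'' \<longrightarrow>
        coind_map E B \<alpha> Y (compose (carrier Y) k' k) =
        compose (carrier (coind E B \<alpha> Y)) (coind_map E B \<alpha> Y' k') (coind_map E B \<alpha> Y k))) \<and>
     ((\<forall>(P :: ('x, 'b) acted) (Y :: ('y, 'e) acted). pt_obj B P \<and> pt_obj E Y \<longrightarrow>
        bij_betw (coind_adj E B \<alpha> P Y)
          (pt_hom B P (coind E B \<alpha> Y)) (pt_hom E (restr \<alpha> P) Y)) \<and>
     (\<forall>(P :: ('x, 'b) acted) (P' :: ('x1, 'b) acted) (Y :: ('y, 'e) acted) h g.
        pt_obj B P \<and> pt_obj B P' \<and> pt_obj E Y \<and>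
        h \<in> pt_hom B P' P \<and> g \<in> pt_hom B P (coind E B \<alpha> Y) \<longrightarrow>
        coind_adj E B \<alpha> P' Y (compose (carrier P') g h) =
        compose (carrier P') (coind_adj E B \<alpha> P Y g) h) \<and>
     (\<forall>(P :: ('x, 'b) acted) (Y :: ('y, 'e) acted) (Y' :: ('y1, 'e) acted) k g.
        pt_obj B P \<and> pt_obj E Y \<and> pt_obj E Y' \<and>
        k \<in> pt_hom E Y Y' \<and> g \<in> pt_hom B P (coind E B \<alpha> Y) \<longrightarrow>
        coind_adj E B \<alpha> P Y' (compose (carrier P) (coind_map E B \<alpha> Y k) g) =
        compose (carrier P) k (coind_adj E B \<alpha> P Y g))) \<and>
     (\<forall>Y :: ('y, 'e) acted. pt_obj E Y \<longrightarrow>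
       induces_action_on B (hom_acted E B \<alpha> Y) (t_inf B (hom_acted E B \<alpha> Y)) \<and>
       (\<forall>F. induces_action_on B (hom_acted E B \<alpha> Y) F \<longrightarrow>
          (\<forall>i\<ge>1. F i \<subseteq> t_inf B (hom_acted E B \<alpha> Y) i)))"
proof (intro conjI allI impI; (elim conjE)?)
  fix P :: "('x, 'b) acted" assume "pt_obj B P"
  then show "pt_obj E (restr \<alpha> P)" by (rule pt_obj_restr[OF assms])
next
  fix P :: "('x, 'b) acted" and P' :: "('x1, 'b) acted" and h
  assume "h \<in> pt_hom B P P'"
  then show "h \<in> pt_hom E (restr \<alpha> P) (restr \<alpha> P')" by (rule pt_hom_restr[OF assms(3)])
next
  fix Y :: "('y, 'e) acted" assume "pt_obj E Y"
  then interpret coinduction E B \<alpha> Y by (rule coinduction.intro[OF assms])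
  show "pt_obj B (coind E B \<alpha> Y)" by (rule pt_obj_coind)
next
  fix Y :: "('y, 'e) acted" and Y' :: "('y1, 'e) acted" and k
  assume "pt_obj E Y" "pt_obj E Y'" "k \<in> pt_hom E Y Y'"
  then show "coind_map E B \<alpha> Y k \<in> pt_hom B (coind E B \<alpha> Y) (coind E B \<alpha> Y')"
    by (intro coind_map_hom coinduction.intro assms)
next
  fix Y :: "('y, 'e) acted" assume "pt_obj E Y"
  then interpret coinduction E B \<alpha> Y by (rule coinduction.intro[OF assms])
  show "coind_map E B \<alpha> Y (\<lambda>y\<in>carrier Y. y) = (\<lambda>u\<in>carrier (coind E B \<alpha> Y). u)"
    by (rule coind_map_id)
next
  fix Y :: "('y, 'e) acted" and Y' :: "('y1, 'e) acted" and Y'' :: "('y2, 'e) acted" and k k'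
  assume "pt_obj E Y" "pt_obj E Y'" "k \<in> pt_hom E Y Y'"
  then show "coind_map E B \<alpha> Y (compose (carrier Y) k' k) =
      compose (carrier (coind E B \<alpha> Y)) (coind_map E B \<alpha> Y' k') (coind_map E B \<alpha> Y k)"
    by (intro coind_map_compose coinduction.intro assms)
next
  fix P :: "('x, 'b) acted" and Y :: "('y, 'e) acted"
  assume P: "pt_obj B P" and "pt_obj E Y"
  then interpret coinduction E B \<alpha> Y by (intro coinduction.intro assms)
  show "bij_betw (coind_adj E B \<alpha> P Y) (pt_hom B P (coind E B \<alpha> Y)) (pt_hom E (restr \<alpha> P) Y)"
    by (rule coind_adj_bij[OF P])
next
  fix P :: "('x, 'b) acted" and P' :: "('x1, 'b) acted" and Y :: "('y, 'e) acted" and h g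
  assume "h \<in> pt_hom B P' P"
  then show "coind_adj E B \<alpha> P' Y (compose (carrier P') g h) =
      compose (carrier P') (coind_adj E B \<alpha> P Y g) h"
    by (rule coind_adj_natural_left)
next
  fix P :: "('x, 'b) acted" and Y :: "('y, 'e) acted" and Y' :: "('y1, 'e) acted" and k g
  assume "pt_obj E Y" "pt_obj E Y'" "k \<in> pt_hom E Y Y'" "g \<in> pt_hom B P (coind E B \<alpha> Y)"
  then show "coind_adj E B \<alpha> P Y' (compose (carrier P) (coind_map E B \<alpha> Y k) g) =
      compose (carrier P) k (coind_adj E B \<alpha> P Y g)"
    by (intro coind_adj_natural_right coinduction.intro assms)
next
  fix Y :: "('y, 'e) acted" assume "pt_obj E Y"
  then interpret coinduction E B \<alpha> Y by (rule coinduction.intro[OF assms])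
  show "induces_action_on B (hom_acted E B \<alpha> Y) (t_inf B (hom_acted E B \<alpha> Y))"
    by (rule H.induces_action_on_t_inf[OF sub_acted_filt_H invariant_filtration_H])
next
  fix Y :: "('y, 'e) acted" and F and i :: nat
  assume "pt_obj E Y" and F: "induces_action_on B (hom_acted E B \<alpha> Y) F" "1 \<le> i"
  then interpret coinduction E B \<alpha> Y by (intro coinduction.intro assms)
  show "F i \<subseteq> t_inf B (hom_acted E B \<alpha> Y) i"
    by (rule H.induces_action_on_subset_t_inf[OF sub_acted_filt_H invariant_filtration_H F])
qed

end
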